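(* Let $N,d,m$ be positive integers, $A_1,\dots,A_N\in\mathcal M_d(\mathbb C)$, $B\in\mathcal M_{d,m}(\mathbb C)$, $\Lambda=(\Lambda_1,\dots,\Lambda_N)\in(0,+\infty)^N$, and $T\in(0,+\infty)$. Then the system $$x(t)=\sum_{j=1}^N A_j x(t-\Lambda_j)+Bu(t),\qquad x(t)\in\mathbb C^d,\ u(t)\in\mathbb C^m,$$ is approximately controllable in time $T$ if and only if it is approximately controllable to constants in time $T$.
   Context: Let $\Lambda_{\max}=\max_j\Lambda_j$, $\mathsf X=L^2((-\Lambda_{\max},0),\mathbb C^d)$, $\mathsf Y_T=L^2((0,T),\mathbb C^m)$. For $x_0\in\mathsf X$ and $u\in\mathsf Y_T$, the solution with initial condition $x_0$ and control $u$ is the unique (up to a.e. equality) function $x:(-\Lambda_{\max},T)\to\mathbb C^d$ equal to $x_0$ on $(-\Lambda_{\max},0)$ and satisfying the equation for (almost) every $t\in(0,T)$. For $t \in [0,T]$, $x_t\in\mathsf X$ is $x_t(s)=x(t+s)$, $s\in(-\Lambda_{\max},0)$. The system is approximately controllable in time $T$ if for every $x_0,y\in\mathsf X$ and $\varepsilon>0$ there is $u\in\mathsf Y_T$ such that the solution with initial condition $x_0$ and control $u$ satisfies $\|x_T-y\|_{\mathsf X}<\varepsilon$. Let $\mathsf K\subset\mathsf X$ be the set of constant functions $(-\Lambda_{\max},0)\to\mathbb C^d$. The system is approximately controllable to constants in time $T$ if for every $y\in\mathsf K$ and $\varepsilon>0$ there is $u\in\mathsf Y_T$ such that the solution with initial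 condition $0$ and control $u$ satisfies $\|x_T-y\|_{\mathsf X}<\varepsilon$. *)

theory Defs
  imports "HOL-Analysis.Analysis"
begin

text \<open>
  Elements of the \<open>L\<^sup>2\<close> spaces are represented by functions on the whole real line. Only their
  values on \<open>S\<close>, up to a null set, matter. The norm on \<open>complex^'d\<close> is the Hermitian one.
\<close>

definition L2_space :: "real set \<Rightarrow> (real \<Rightarrow> 'a::euclidean_space) set" where
  "L2_space S = {f. f \<in> borel_measurable (lebesgue_on S) \<and>
                    integrable (lebesgue_on S) (\<lambda>s. (norm (f s))\<^sup>2)}"

definition L2_norm :: "real set \<Rightarrow> (real \<Rightarrow> 'a::euclidean_space) \<Rightarrow> real" where
  "L2_norm S f = sqrt (LINT s|lebesgue_on S. (norm (f s))\<^sup>2)"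

definition max_delay :: "nat \<Rightarrow> (nat \<Rightarrow> real) \<Rightarrow> real" where
  "max_delay N \<Lambda> = Max (\<Lambda> ` {1..N})"

definition history_interval :: "nat \<Rightarrow> (nat \<Rightarrow> real) \<Rightarrow> real set" where
  "history_interval N \<Lambda> = {- max_delay N \<Lambda> <..< 0}"

definition state_space :: "nat \<Rightarrow> (nat \<Rightarrow> real) \<Rightarrow> (real \<Rightarrow> complex^'d::finite) set" where
  "state_space N \<Lambda> = L2_space (history_interval N \<Lambda>)"

definition control_space :: "real \<Rightarrow> (real \<Rightarrow> complex^'m::finite) set" where
  "control_space T = L2_space {0<..<T}"

definition constant_states :: "nat \<Rightarrow> (nat \<Rightarrow> real) \<Rightarrow> (real \<Rightarrow> complex^'d::finite) set" where
  "constant_states N \<Lambda> = {y. \<exists>c. \<forall>s\<in>history_interval N \<Lambda>. y s = c}"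

text \<open>
  Since the initial state and the control are only given up to null sets, both the initial
  condition and the equation are required almost everywhere. For positive delays this determines
  \<open>x\<close> up to a null set of \<open>{- max_delay N \<Lambda> <..< T}\<close>; the values of \<open>x\<close> at \<open>0\<close> and outside
  this interval are irrelevant.
\<close>

definition is_solution ::
  "nat \<Rightarrow> (nat \<Rightarrow> complex^'d^'d) \<Rightarrow> complex^'m^'d \<Rightarrow> (nat \<Rightarrow> real) \<Rightarrow> real
    \<Rightarrow> (real \<Rightarrow> complex^'d::finite) \<Rightarrow> (real \<Rightarrow> complex^'m::finite) \<Rightarrow> (real \<Rightarrow> complex^'d) \<Rightarrow> bool" where
  "is_solution N A B \<Lambda> T x0 u x \<longleftrightarrow>
     (AE s in lebesgue_on (history_interval N \<Lambda>). x s = x0 s) \<and>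
     (AE t in lebesgue_on {0<..<T}. x t = (\<Sum>j=1..N. A j *v x (t - \<Lambda> j)) + B *v u t)"

definition history :: "(real \<Rightarrow> complex^'d::finite) \<Rightarrow> real \<Rightarrow> real \<Rightarrow> complex^'d" where
  "history x t = (\<lambda>s. x (t + s))"

text \<open>
  Solutions are unique up to null sets, so ``the solution satisfies'' is expressed by the
  existence of a solution with the stated property. Membership of the final state in the
  state space is stated explicitly because the Bochner integral in \<^const>\<open>L2_norm\<close> is \<open>0\<close>
  on functions that are not square-integrable.
\<close>

definition steers_near ::
  "nat \<Rightarrow> (nat \<Rightarrow> complex^'d^'d) \<Rightarrow> complex^'m^'d \<Rightarrow> (nat \<Rightarrow> real) \<Rightarrow> real
    \<Rightarrow> (real \<Rightarrow> complex^'d::finite) \<Rightarrow> (real \<Rightarrow> complex^'m::finite) \<Rightarrow> (real \<Rightarrow> complex^'d) \<Rightarrow> real \<Rightarrow> bool" where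
  "steers_near N A B \<Lambda> T x0 u y \<epsilon> \<longleftrightarrow>
     (\<exists>x. is_solution N A B \<Lambda> T x0 u x \<and>
          history x T \<in> state_space N \<Lambda> \<and>
          L2_norm (history_interval N \<Lambda>) (\<lambda>s. history x T s - y s) < \<epsilon>)"

definition approx_controllable ::
  "nat \<Rightarrow> (nat \<Rightarrow> complex^'d^'d) \<Rightarrow> complex^'m^'d \<Rightarrow> (nat \<Rightarrow> real) \<Rightarrow> real \<Rightarrow> bool" where
  "approx_controllable N A B \<Lambda> T \<longleftrightarrow>
     (\<forall>x0\<in>state_space N \<Lambda>. \<forall>y\<in>state_space N \<Lambda>. \<forall>\<epsilon>>0.
        \<exists>u\<in>control_space T. steers_near N A B \<Lambda> T x0 u y \<epsilon>)"

definition approx_controllable_to_constants ::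
  "nat \<Rightarrow> (nat \<Rightarrow> complex^'d^'d) \<Rightarrow> complex^'m^'d \<Rightarrow> (nat \<Rightarrow> real) \<Rightarrow> real \<Rightarrow> bool" where
  "approx_controllable_to_constants N A B \<Lambda> T \<longleftrightarrow>
     (\<forall>y\<in>constant_states N \<Lambda>. \<forall>\<epsilon>>0.
        \<exists>u\<in>control_space T. steers_near N A B \<Lambda> T (\<lambda>_. 0) u y \<epsilon>)"

end

theory Submission
  imports Defs
begin

text \<open>
  Let \<open>R\<close> be the set of final states reachable from the zero state. If a control \<open>u\<close> produces the
  solution \<open>x\<close> from zero, then its primitive \<open>\<integral>\<^sub>0\<^sup>t u\<close> produces \<open>\<integral>\<^sub>0\<^sup>t x\<close>, whose final state is a
  constant plus the primitive of the final state of \<open>x\<close>. So as soon as the closure of \<open>R\<close> contains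
  the constants, it is stable under integration from the left end point \<open>a\<close>, hence contains all
  \<open>(s - a) ^ n *\<^sub>R v\<close>, hence all polynomials, and is the whole space by density. A nonzero initial
  state is dealt with by linearity.
\<close>

section \<open>Square-integrable functions\<close>

text \<open>Why primitives solve the equation again: a solution with zero initial state, continued
  by zero to the whole past, satisfies the equation almost everywhere on the half-line up to
  \<open>T\<close>. Integrating from minus infinity commutes with the delays and with the matrices,
  so no boundary term appears. A nonzero past would leave such a term, hence the detour through the
  zero initial state. Why constants are exactly what is missing: the window of the primitive also
  carries the integral of the solution accumulated before the window opens. This vector depends on
  the control and cannot be prescribed, so it has to be subtracted inside the closure. Why the
  closure inherits the stability: integration from the left end point is a bounded operator on L2 of
  a bounded interval. The delays may be incommensurable and \<open>T\<close> may be shorter than the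
  largest delay, so the argument avoids any explicit formula for the final state in terms of the
  control.\<close>

lemma norm_add_square_le: "(norm (x + y :: 'a::real_normed_vector))\<^sup>2 \<le> 2 * (norm x)\<^sup>2 + 2 * (norm y)\<^sup>2"
proof -
  have "(norm (x + y))\<^sup>2 \<le> (norm x + norm y)\<^sup>2"
    by (intro power_mono norm_triangle_ineq) auto
  also have "\<dots> \<le> 2 * (norm x)\<^sup>2 + 2 * (norm y)\<^sup>2"
    using sum_squares_bound[of "norm x" "norm y"] by (simp add: power2_sum)
  finally show ?thesis .
qed

lemma L2_spaceI:
  "f \<in> borel_measurable (lebesgue_on S) \<Longrightarrow> integrable (lebesgue_on S) (\<lambda>s. (norm (f s))\<^sup>2) \<Longrightarrow> f \<in> L2_space S"
  by (simp add: L2_space_def)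

lemma L2_spaceD:
  assumes "f \<in> L2_space S"
  shows "f \<in> borel_measurable (lebesgue_on S)" "integrable (lebesgue_on S) (\<lambda>s. (norm (f s))\<^sup>2)"
  using assms by (auto simp: L2_space_def)

lemma L2_space_dominated:
  assumes "g \<in> L2_space S" "f \<in> borel_measurable (lebesgue_on S)"
    "AE s in lebesgue_on S. norm (f s) \<le> C * norm (g s)"
  shows "f \<in> L2_space S"
proof (rule L2_spaceI[OF assms(2)])
  show "integrable (lebesgue_on S) (\<lambda>s. (norm (f s))\<^sup>2)"
  proof (rule Bochner_Integration.integrable_bound)
    show "integrable (lebesgue_on S) (\<lambda>s. C\<^sup>2 * (norm (g s))\<^sup>2)"
      using L2_spaceD(2)[OF assms(1)] by simp
    show "AE s in lebesgue_on S. norm ((norm (f s))\<^sup>2) \<le> norm (C\<^sup>2 * (norm (g s))\<^sup>2)"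
      using assms(3) by eventually_elim (auto simp: power_mult_distrib[symmetric] intro!: power_mono)
  qed (use assms(2) in measurable)
qed

lemma L2_space_add:
  assumes "f \<in> L2_space S" "g \<in> L2_space S"
  shows "(\<lambda>s. f s + g s) \<in> L2_space S"
proof (rule L2_spaceI)
  note [measurable] = L2_spaceD(1)[OF assms(1)] L2_spaceD(1)[OF assms(2)]
  show "(\<lambda>s. f s + g s) \<in> borel_measurable (lebesgue_on S)" by measurable
  show "integrable (lebesgue_on S) (\<lambda>s. (norm (f s + g s))\<^sup>2)"
  proof (rule Bochner_Integration.integrable_bound)
    show "integrable (lebesgue_on S) (\<lambda>s. 2 * (norm (f s))\<^sup>2 + 2 * (norm (g s))\<^sup>2)"
      using L2_spaceD(2)[OF assms(1)] L2_spaceD(2)[OF assms(2)] by simp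
    show "AE s in lebesgue_on S. norm ((norm (f s + g s))\<^sup>2) \<le> norm (2 * (norm (f s))\<^sup>2 + 2 * (norm (g s))\<^sup>2)"
      by (intro AE_I2) (simp add: norm_add_square_le)
  qed measurable
qed

lemma L2_space_bounded_linear:
  assumes "f \<in> L2_space S" "bounded_linear h"
  shows "(\<lambda>s. h (f s)) \<in> L2_space S"
proof -
  obtain K where "\<And>x. norm (h x) \<le> norm x * K"
    using bounded_linear.bounded[OF assms(2)] by blast
  moreover have "(\<lambda>s. h (f s)) \<in> borel_measurable (lebesgue_on S)"
    using borel_measurable_continuous_onI[OF linear_continuous_on[OF assms(2)]] L2_spaceD(1)[OF assms(1)]
    by (rule measurable_compose_rev)
  ultimately show ?thesis
    by (intro L2_space_dominated[OF assms(1), of _ K]) (simp_all add: mult.commute)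
qed

lemma L2_space_scaleR: "f \<in> L2_space S \<Longrightarrow> (\<lambda>s. c *\<^sub>R f s) \<in> L2_space S"
  by (rule L2_space_bounded_linear[OF _ bounded_linear_scaleR_right])

lemma L2_space_diff: "f \<in> L2_space S \<Longrightarrow> g \<in> L2_space S \<Longrightarrow> (\<lambda>s. f s - g s) \<in> L2_space S"
  using L2_space_add[of f S "\<lambda>s. (-1) *\<^sub>R g s"] L2_space_scaleR[of g S "-1"] by simp

lemma L2_space_zero: "(\<lambda>s. 0) \<in> L2_space S"
  by (rule L2_spaceI) auto

lemma L2_space_sum:
  "(\<And>i. i \<in> I \<Longrightarrow> f i \<in> L2_space S) \<Longrightarrow> (\<lambda>s. \<Sum>i\<in>I. f i s) \<in> L2_space S"
  by (induction I rule: infinite_finite_induct) (auto intro: L2_space_add L2_space_zero)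

text \<open>Moves questions about \<open>S\<close> to the whole line, where translation invariance
  and pointwise sums of pieces are directly available.\<close>

lemma L2_space_iff_zero_extension:
  assumes "S \<in> sets lebesgue"
  shows "f \<in> L2_space S \<longleftrightarrow> (\<lambda>s. if s \<in> S then f s else 0) \<in> L2_space UNIV"
proof -
  have "(\<lambda>s. (norm (if s \<in> S then f s else 0))\<^sup>2) = (\<lambda>s. if s \<in> S then (norm (f s))\<^sup>2 else 0)"
    by auto
  then show ?thesis
    using assms borel_measurable_if[OF assms, of f] Lebesgue_Measure.integrable_restrict_UNIV[OF assms, of "\<lambda>s. (norm (f s))\<^sup>2"]
    by (simp add: L2_space_def lebesgue_on_UNIV_eq)
qed

text \<open>Measurability of \<open>g\<close> is a conclusion here: it follows from completeness of
  Lebesgue measure. This matters for solutions, which are constrained only almost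
  everywhere.\<close>

lemma L2_space_AE_cong:
  assumes "f \<in> L2_space S" "AE s in lebesgue_on S. f s = g s" "S \<in> sets lebesgue"
  shows "g \<in> L2_space S"
proof -
  have "(\<lambda>s. if s \<in> S then f s else 0) \<in> borel_measurable lebesgue"
    using L2_spaceD(1)[OF assms(1)] borel_measurable_if[OF assms(3), of f] by simp
  moreover have "AE s in lebesgue. (if s \<in> S then f s else 0) = (if s \<in> S then g s else 0)"
    using assms(2,3) by (auto simp: AE_restrict_space_iff)
  ultimately have "g \<in> borel_measurable (lebesgue_on S)"
    unfolding borel_measurable_if[OF assms(3), symmetric] by (rule borel_measurable_AE)
  with assms show ?thesis
    by (auto intro: L2_space_dominated[of f _ _ 1] elim: eventually_mono)
qed

lemma L2_space_subset:
  assumes "f \<in> L2_space S" "R \<subseteq> S" "R \<in> sets lebesgue" "S \<in> sets lebesgue"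
  shows "f \<in> L2_space R"
proof (rule L2_spaceI)
  show "f \<in> borel_measurable (lebesgue_on R)"
    using measurable_restrict_mono[OF L2_spaceD(1)[OF assms(1)] assms(2)] .
  have zero: "(\<lambda>s. if s \<in> S then if s \<in> R then (norm (f s))\<^sup>2 else 0 else 0) = (\<lambda>s. if s \<in> R then (norm (f s))\<^sup>2 else 0)"
    using assms(2) by (auto simp: fun_eq_iff)
  have "integrable (lebesgue_on S) (\<lambda>s. if s \<in> R then (norm (f s))\<^sup>2 else 0)"
  proof (rule Bochner_Integration.integrable_bound[OF L2_spaceD(2)[OF assms(1)]])
    show "(\<lambda>s. if s \<in> R then (norm (f s))\<^sup>2 else 0) \<in> borel_measurable (lebesgue_on S)"
      using borel_measurable_if_lebesgue_on[OF assms(3,4,2), of "\<lambda>s. (norm (f s))\<^sup>2"]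
        \<open>f \<in> borel_measurable (lebesgue_on R)\<close> by simp
  qed auto
  then show "integrable (lebesgue_on R) (\<lambda>s. (norm (f s))\<^sup>2)"
    using Lebesgue_Measure.integrable_restrict_UNIV[OF assms(4), of "\<lambda>s. if s \<in> R then (norm (f s))\<^sup>2 else 0"]
      Lebesgue_Measure.integrable_restrict_UNIV[OF assms(3), of "\<lambda>s. (norm (f s))\<^sup>2"] assms(2)
    by (simp add: zero)
qed

lemma L2_space_Un:
  assumes "f \<in> L2_space R" "f \<in> L2_space S" "R \<in> sets lebesgue" "S \<in> sets lebesgue"
  shows "f \<in> L2_space (R \<union> S)"
proof -
  \<comment> \<open>Splitting the union into the disjoint pieces \<open>R\<close> and
    \<open>S - R\<close> lets the two zero extensions be added without counting the overlap
    twice.\<close>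
  have "f \<in> L2_space (S - R)"
    using L2_space_subset[OF assms(2) _ _ assms(4)] assms(3,4) by blast
  then have "(\<lambda>s. if s \<in> S - R then f s else 0) \<in> L2_space UNIV"
    using assms L2_space_iff_zero_extension by blast
  moreover have "(\<lambda>s. if s \<in> R then f s else 0) \<in> L2_space UNIV"
    using assms L2_space_iff_zero_extension by blast
  ultimately have "(\<lambda>s. (if s \<in> R then f s else 0) + (if s \<in> S - R then f s else 0)) \<in> L2_space UNIV"
    by (rule L2_space_add[rotated])
  also have "(\<lambda>s. (if s \<in> R then f s else 0) + (if s \<in> S - R then f s else 0)) = (\<lambda>s. if s \<in> R \<union> S then f s else 0)"
    by (simp add: fun_eq_iff)
  finally show ?thesis
    using L2_space_iff_zero_extension[of "R \<union> S" f] assms(3,4) by simp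
qed

lemma L2_space_null:
  assumes "S \<in> null_sets lebesgue"
  shows "f \<in> L2_space S"
proof (rule L2_space_AE_cong[OF L2_space_zero])
  have "S \<in> sets lebesgue" using assms by auto
  then show "AE s in lebesgue_on S. 0 = f s"
    using AE_not_in[OF assms] by (auto simp: AE_restrict_space_iff elim: eventually_mono)
qed (use assms in auto)

lemma L2_space_translate:
  assumes "f \<in> L2_space {a<..<b}"
  shows "(\<lambda>s. f (c + s)) \<in> L2_space {a - c<..<b - c}"
proof -
  let ?g = "\<lambda>s. if s \<in> {a<..<b} then f s else 0"
  have g: "?g \<in> L2_space UNIV"
    using assms L2_space_iff_zero_extension[of "{a<..<b}" f] by simp
  have m: "?g \<in> borel_measurable lebesgue" "integrable lebesgue (\<lambda>s. (norm (?g s))\<^sup>2)"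
    using L2_spaceD[OF g] by (simp_all add: lebesgue_on_UNIV_eq)
  have "(\<lambda>s. c + s) \<in> lebesgue \<rightarrow>\<^sub>M lebesgue"
    using lebesgue_affine_measurable[where c="\<lambda>_::real. 1" and t=c] by simp
  then have "(\<lambda>s. ?g (c + s)) \<in> borel_measurable lebesgue"
    using m(1) by (rule measurable_compose)
  moreover have "integrable lebesgue (\<lambda>s. (norm (?g (c + s)))\<^sup>2)"
    using lebesgue_integrable_real_affine_iff[of 1 "\<lambda>s. (norm (?g s))\<^sup>2" c] m(2)
    by (simp only: mult_1)
  ultimately have "(\<lambda>s. ?g (c + s)) \<in> L2_space UNIV"
    by (auto intro!: L2_spaceI simp: lebesgue_on_UNIV_eq)
  moreover have "(\<lambda>s. ?g (c + s)) = (\<lambda>s. if s \<in> {a - c<..<b - c} then f (c + s) else 0)"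
    by (auto simp: fun_eq_iff)
  ultimately show ?thesis
    using L2_space_iff_zero_extension[of "{a - c<..<b - c}" "\<lambda>s. f (c + s)"] by simp
qed

section \<open>Bounded domains: constants, integrability and the L1 norm\<close>

lemma finite_measure_lebesgue_on_bounded:
  assumes "bounded S" "S \<in> sets lebesgue"
  shows "finite_measure (lebesgue_on S)"
proof
  show "emeasure (lebesgue_on S) (space (lebesgue_on S)) \<noteq> \<infinity>"
    using fmeasurableD2[OF bounded_set_imp_lmeasurable[OF assms]] assms(2)
    by (simp add: emeasure_restrict_space space_restrict_space del: emeasure_completion)
qed

lemma L2_space_bounded_measurable:
  fixes f :: "real \<Rightarrow> 'a::euclidean_space"
  assumes "bounded S" "S \<in> sets lebesgue" "f \<in> borel_measurable (lebesgue_on S)" "\<And>s. s \<in> S \<Longrightarrow> norm (f s) \<le> K"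
  shows "f \<in> L2_space S"
proof (rule L2_spaceI[OF assms(3)])
  interpret finite_measure "lebesgue_on S" by (rule finite_measure_lebesgue_on_bounded[OF assms(1,2)])
  show "integrable (lebesgue_on S) (\<lambda>s. (norm (f s))\<^sup>2)"
    using assms(3) by (intro integrable_const_bound[of _ "K\<^sup>2"]) (auto simp: assms(4) power_mono)
qed

lemma L2_space_const:
  fixes c :: "'a::euclidean_space"
  assumes "bounded S" "S \<in> sets lebesgue"
  shows "(\<lambda>s. c) \<in> L2_space S"
  by (rule L2_space_bounded_measurable[OF assms, of _ "norm c"]) auto

text \<open>Weighted arithmetic-geometric mean inequality. The weight \<open>\<eta>\<close> stays
  free so that it can later be matched to the size of the function.\<close>

lemma norm_le_average_square:
  fixes x :: "'a::real_normed_vector"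
  assumes "\<eta> > 0"
  shows "norm x \<le> (\<eta> + (norm x)\<^sup>2 / \<eta>) / 2"
proof -
  have "2 * norm x * \<eta> \<le> \<eta>\<^sup>2 + (norm x)\<^sup>2"
    using sum_squares_bound[of "norm x" \<eta>] by (simp add: algebra_simps)
  then show ?thesis using assms by (simp add: field_simps power2_eq_square)
qed

lemma L2_space_integrable:
  fixes f :: "real \<Rightarrow> 'a::euclidean_space"
  assumes "bounded S" "S \<in> sets lebesgue" "f \<in> L2_space S"
  shows "integrable (lebesgue_on S) f"
proof (rule Bochner_Integration.integrable_bound)
  interpret finite_measure "lebesgue_on S" by (rule finite_measure_lebesgue_on_bounded[OF assms(1,2)])
  show "integrable (lebesgue_on S) (\<lambda>s. (1 + (norm (f s))\<^sup>2 / 1) / 2)"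
    using L2_spaceD(2)[OF assms(3)] by simp
  show "AE s in lebesgue_on S. norm (f s) \<le> norm ((1 + (norm (f s))\<^sup>2 / 1) / 2)"
    using norm_le_average_square[of 1 "f _"] by (intro AE_I2) (simp add: field_simps)
qed (use L2_spaceD[OF assms(3)] in auto)

text \<open>A weak substitute for the Cauchy--Schwarz inequality.\<close>

lemma L1_le_L2:
  fixes f :: "real \<Rightarrow> 'a::euclidean_space"
  assumes "bounded S" "S \<in> sets lebesgue" "f \<in> L2_space S" "\<eta> > 0"
  shows "(LINT s|lebesgue_on S. norm (f s)) \<le> (\<eta> * measure lebesgue S + (LINT s|lebesgue_on S. (norm (f s))\<^sup>2) / \<eta>) / 2"
proof -
  interpret finite_measure "lebesgue_on S" by (rule finite_measure_lebesgue_on_bounded[OF assms(1,2)])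
  note int = L2_spaceD(2)[OF assms(3)]
  have "(LINT s|lebesgue_on S. norm (f s)) \<le> (LINT s|lebesgue_on S. (\<eta> + (norm (f s))\<^sup>2 / \<eta>) / 2)"
    using L2_space_integrable[OF assms(1-3)] int
    by (intro integral_mono norm_le_average_square assms(4)) auto
  also have "\<dots> = (\<eta> * measure lebesgue S + (LINT s|lebesgue_on S. (norm (f s))\<^sup>2) / \<eta>) / 2"
    using int assms(2) by (simp add: measure_restrict_space space_restrict_space)
  finally show ?thesis .
qed

section \<open>Density in the space of square-integrable functions\<close>

text \<open>The members of \<open>W\<close> are functions rather than classes modulo null sets, so
  linearity is required pointwise. The domain is bounded so that constants, polynomials and
  primitives are square-integrable on it.\<close>

locale L2_subspace =
  fixes S :: "real set" and W :: "(real \<Rightarrow> 'a::euclidean_space) set"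
  assumes bounded_domain: "bounded S" and lebesgue_domain: "S \<in> sets lebesgue"
    and subset_L2: "W \<subseteq> L2_space S"
    and zero_mem: "(\<lambda>s. 0) \<in> W"
    and add_mem: "\<And>f g. f \<in> W \<Longrightarrow> g \<in> W \<Longrightarrow> (\<lambda>s. f s + g s) \<in> W"
    and scaleR_mem: "\<And>c f. f \<in> W \<Longrightarrow> (\<lambda>s. c *\<^sub>R f s) \<in> W"
begin

text \<open>The square of the L2 distance: it avoids roots and Minkowski's inequality, at the price
  of factors 2 in the triangle inequality.\<close>

definition sqdist :: "(real \<Rightarrow> 'a) \<Rightarrow> (real \<Rightarrow> 'a) \<Rightarrow> real" where
  "sqdist f g = (LINT s|lebesgue_on S. (norm (f s - g s))\<^sup>2)"

definition L2_closure :: "(real \<Rightarrow> 'a) set" where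
  "L2_closure = {y \<in> L2_space S. \<forall>\<epsilon>>0. \<exists>w\<in>W. sqdist w y < \<epsilon>}"

lemma sqdist_integrable:
  "f \<in> L2_space S \<Longrightarrow> g \<in> L2_space S \<Longrightarrow> integrable (lebesgue_on S) (\<lambda>s. (norm (f s - g s))\<^sup>2)"
  by (rule L2_spaceD(2)[OF L2_space_diff])

lemma sqdist_add_le:
  assumes "f \<in> L2_space S" "g \<in> L2_space S" "f' \<in> L2_space S" "g' \<in> L2_space S"
  shows "sqdist (\<lambda>s. f s + f' s) (\<lambda>s. g s + g' s) \<le> 2 * sqdist f g + 2 * sqdist f' g'"
proof -
  have "sqdist (\<lambda>s. f s + f' s) (\<lambda>s. g s + g' s) \<le>
    (LINT s|lebesgue_on S. 2 * (norm (f s - g s))\<^sup>2 + 2 * (norm (f' s - g' s))\<^sup>2)"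
    unfolding sqdist_def
  proof (rule integral_mono)
    show "(norm (f s + f' s - (g s + g' s)))\<^sup>2 \<le> 2 * (norm (f s - g s))\<^sup>2 + 2 * (norm (f' s - g' s))\<^sup>2" for s
      using norm_add_square_le[of "f s - g s" "f' s - g' s"] by (simp add: algebra_simps)
  qed (intro Bochner_Integration.integrable_add integrable_mult_right sqdist_integrable L2_space_add assms)+
  also have "\<dots> = 2 * sqdist f g + 2 * sqdist f' g'"
    unfolding sqdist_def using sqdist_integrable[OF assms(1,2)] sqdist_integrable[OF assms(3,4)] by simp
  finally show ?thesis .
qed

lemma sqdist_triangle:
  assumes "f \<in> L2_space S" "g \<in> L2_space S" "h \<in> L2_space S"
  shows "sqdist f h \<le> 2 * sqdist f g + 2 * sqdist g h"
proof -
  \<comment> \<open>The pairs \<open>f\<close>, \<open>g\<close> and \<open>g\<close>,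
    \<open>h\<close> are added; the common summand \<open>g\<close> then cancels in the
    difference.\<close>
  have "sqdist (\<lambda>s. f s + g s) (\<lambda>s. g s + h s) \<le> 2 * sqdist f g + 2 * sqdist g h"
    by (rule sqdist_add_le) (fact assms)+
  then show ?thesis by (simp add: sqdist_def)
qed

lemma mem_closure: "w \<in> W \<Longrightarrow> w \<in> L2_closure"
  using subset_L2 by (auto simp: L2_closure_def sqdist_def intro!: bexI[of _ w])

lemma closure_subset_L2: "y \<in> L2_closure \<Longrightarrow> y \<in> L2_space S"
  by (simp add: L2_closure_def)

lemma closure_approx:
  assumes "y \<in> L2_closure" "\<epsilon> > 0"
  obtains w where "w \<in> W" "w \<in> L2_space S" "sqdist w y < \<epsilon>"
  using assms subset_L2 unfolding L2_closure_def by blast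

lemma closure_closed:
  assumes y: "y \<in> L2_space S" and "\<And>\<epsilon>. \<epsilon> > 0 \<Longrightarrow> \<exists>z\<in>L2_closure. sqdist z y < \<epsilon>"
  shows "y \<in> L2_closure"
  unfolding L2_closure_def
proof (intro CollectI conjI y allI impI)
  fix \<epsilon> :: real assume "\<epsilon> > 0"
  then obtain z where z: "z \<in> L2_closure" "sqdist z y < \<epsilon> / 4"
    using assms(2)[of "\<epsilon> / 4"] by auto
  obtain w where w: "w \<in> W" "w \<in> L2_space S" "sqdist w z < \<epsilon> / 4"
    using closure_approx[OF z(1), of "\<epsilon> / 4"] \<open>\<epsilon> > 0\<close> by auto
  have "sqdist w y \<le> 2 * sqdist w z + 2 * sqdist z y"
    using w(2) closure_subset_L2[OF z(1)] y by (rule sqdist_triangle)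
  then show "\<exists>w\<in>W. sqdist w y < \<epsilon>"
    using w z by (intro bexI[of _ w]) auto
qed

lemma closure_zero: "(\<lambda>s. 0) \<in> L2_closure"
  by (rule mem_closure[OF zero_mem])

lemma closure_add:
  assumes "f \<in> L2_closure" "g \<in> L2_closure"
  shows "(\<lambda>s. f s + g s) \<in> L2_closure"
  unfolding L2_closure_def
proof (intro CollectI conjI allI impI L2_space_add closure_subset_L2 assms)
  fix \<epsilon> :: real assume \<epsilon>: "\<epsilon> > 0"
  obtain w where w: "w \<in> W" "w \<in> L2_space S" "sqdist w f < \<epsilon> / 4"
    using closure_approx[OF assms(1), of "\<epsilon> / 4"] \<epsilon> by auto
  obtain w' where w': "w' \<in> W" "w' \<in> L2_space S" "sqdist w' g < \<epsilon> / 4"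
    using closure_approx[OF assms(2), of "\<epsilon> / 4"] \<epsilon> by auto
  have "sqdist (\<lambda>s. w s + w' s) (\<lambda>s. f s + g s) \<le> 2 * sqdist w f + 2 * sqdist w' g"
    by (intro sqdist_add_le w w' closure_subset_L2 assms)
  then show "\<exists>w\<in>W. sqdist w (\<lambda>s. f s + g s) < \<epsilon>"
    using w w' by (intro bexI[OF _ add_mem[OF w(1) w'(1)]]) auto
qed

lemma closure_scaleR:
  assumes "f \<in> L2_closure"
  shows "(\<lambda>s. c *\<^sub>R f s) \<in> L2_closure"
  unfolding L2_closure_def
proof (intro CollectI conjI allI impI L2_space_scaleR closure_subset_L2 assms)
  fix \<epsilon> :: real assume \<epsilon>: "\<epsilon> > 0"
  \<comment> \<open>The summand 1 covers the case \<open>c = 0\<close>.\<close>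
  have pos: "0 < \<epsilon> / (c\<^sup>2 + 1)" using \<epsilon> by (simp add: add_nonneg_pos)
  obtain w where w: "w \<in> W" "sqdist w f < \<epsilon> / (c\<^sup>2 + 1)"
    using closure_approx[OF assms pos] by auto
  have nonneg: "0 \<le> sqdist w f" by (simp add: sqdist_def)
  have "sqdist (\<lambda>s. c *\<^sub>R w s) (\<lambda>s. c *\<^sub>R f s) = c\<^sup>2 * sqdist w f"
    by (simp add: sqdist_def scaleR_diff_right[symmetric] power_mult_distrib)
  also have "\<dots> \<le> (c\<^sup>2 + 1) * sqdist w f"
    using nonneg by (simp add: algebra_simps)
  also have "\<dots> < \<epsilon>"
    using w(2) by (simp add: pos_less_divide_eq add_nonneg_pos mult.commute)
  finally show "\<exists>w\<in>W. sqdist w (\<lambda>s. c *\<^sub>R f s) < \<epsilon>"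
    by (intro bexI[OF _ scaleR_mem[OF w(1)]])
qed

lemma closure_sum:
  "(\<And>i. i \<in> I \<Longrightarrow> f i \<in> L2_closure) \<Longrightarrow> (\<lambda>s. \<Sum>i\<in>I. f i s) \<in> L2_closure"
  by (induction I rule: infinite_finite_induct) (auto intro: closure_add closure_zero)

text \<open>Dominated convergence applied to the squared error, which is at most
  \<open>2 * (norm (g s))\<^sup>2 + 2 * (norm (y s))\<^sup>2\<close>. All density arguments below go
  through this form.\<close>

lemma closure_dominated:
  assumes z: "\<And>n. z n \<in> L2_closure" and y: "y \<in> L2_space S"
    and lim: "AE s in lebesgue_on S. (\<lambda>n. z n s) \<longlonglongrightarrow> y s"
    and g: "g \<in> L2_space S" and bound: "\<And>n s. s \<in> S \<Longrightarrow> norm (z n s) \<le> norm (g s)"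
  shows "y \<in> L2_closure"
proof (rule closure_closed[OF y])
  fix \<epsilon> :: real assume "\<epsilon> > 0"
  have "(\<lambda>n. sqdist (z n) y) \<longlonglongrightarrow> (LINT s|lebesgue_on S. 0)"
    unfolding sqdist_def
  proof (rule integral_dominated_convergence)
    show "(\<lambda>s. (norm (z n s - y s))\<^sup>2) \<in> borel_measurable (lebesgue_on S)" for n
      using sqdist_integrable[OF closure_subset_L2[OF z] y] by (rule borel_measurable_integrable)
    show "integrable (lebesgue_on S) (\<lambda>s. 2 * (norm (g s))\<^sup>2 + 2 * (norm (y s))\<^sup>2)"
      using L2_spaceD(2)[OF g] L2_spaceD(2)[OF y] by simp
    show "AE s in lebesgue_on S. (\<lambda>n. (norm (z n s - y s))\<^sup>2) \<longlonglongrightarrow> 0"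
      using lim
    proof eventually_elim
      case (elim s)
      from tendsto_power[OF tendsto_norm[OF tendsto_diff[OF elim tendsto_const[of "y s"]]], of 2]
      show ?case by simp
    qed
    show "AE s in lebesgue_on S. norm ((norm (z n s - y s))\<^sup>2) \<le> 2 * (norm (g s))\<^sup>2 + 2 * (norm (y s))\<^sup>2" for n
    proof (rule AE_I2)
      fix s assume "s \<in> space (lebesgue_on S)"
      then have "s \<in> S" by simp
      have "(norm (z n s - y s))\<^sup>2 \<le> 2 * (norm (z n s))\<^sup>2 + 2 * (norm (y s))\<^sup>2"
        using norm_add_square_le[of "z n s" "- y s"] by simp
      moreover have "(norm (z n s))\<^sup>2 \<le> (norm (g s))\<^sup>2"
        by (rule power_mono[OF bound[OF \<open>s \<in> S\<close>] norm_ge_zero])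
      ultimately show "norm ((norm (z n s - y s))\<^sup>2) \<le> 2 * (norm (g s))\<^sup>2 + 2 * (norm (y s))\<^sup>2"
        by (simp only: real_norm_def abs_power2)
    qed
  qed simp
  then have "eventually (\<lambda>n. sqdist (z n) y < \<epsilon>) sequentially"
    using \<open>\<epsilon> > 0\<close> by (auto dest: order_tendstoD(2))
  then show "\<exists>z\<in>L2_closure. sqdist z y < \<epsilon>"
    using z by (auto simp: eventually_sequentially)
qed

lemma closure_dominated_const:
  assumes z: "\<And>n. z n \<in> L2_closure" and y: "y \<in> L2_space S"
    and lim: "AE s in lebesgue_on S. (\<lambda>n. z n s) \<longlonglongrightarrow> y s"
    and bound: "\<And>n s. s \<in> S \<Longrightarrow> norm (z n s) \<le> K"
  shows "y \<in> L2_closure"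
proof -
  \<comment> \<open>The dominating function must take values in \<open>'a\<close>, so the scalar
    bound \<open>K\<close> is turned into the vector \<open>K *\<^sub>R b\<close>.\<close>
  obtain b :: 'a where b: "norm b = 1" using nonempty_Basis norm_Basis by blast
  show ?thesis
  proof (rule closure_dominated[OF z y lim L2_space_const[OF bounded_domain lebesgue_domain, of "K *\<^sub>R b"]])
    show "norm (z n s) \<le> norm (K *\<^sub>R b)" if "s \<in> S" for n s
      using bound[OF that, of n] b by simp
  qed
qed

text \<open>Cutting off \<open>f\<close> on \<open>{s. norm (f s) > n}\<close> leaves bounded functions, and these are almost
  everywhere limits of uniformly bounded continuous functions.\<close>

lemma closure_eq_L2_if_continuous:
  assumes cont: "\<And>f. continuous_on UNIV f \<Longrightarrow> f \<in> L2_closure"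
  shows "L2_closure = L2_space S"
proof
  have bdd: "f \<in> L2_closure"
    if f: "f \<in> borel_measurable (lebesgue_on S)" and M: "\<And>s. norm (f s) \<le> M" for f M
  proof -
    have "0 \<le> M" using M[of 0] norm_ge_zero order_trans by blast
    obtain N g where N: "negligible N" and g: "\<And>n::nat. continuous_on UNIV (g n)"
      and lim: "\<And>s. s \<notin> N \<Longrightarrow> (\<lambda>n. g n s) \<longlonglongrightarrow> (if s \<in> S then f s else 0)"
      using f measurable_on_iff_borel_measurable[OF lebesgue_domain, of f]
      unfolding measurable_on_def by auto
    \<comment> \<open>The continuous approximants \<open>g n\<close> converge off a null set but
      need not be bounded. Projecting them onto the ball keeps them continuous, bounds them by
      \<open>M\<close>, and preserves the limit because \<open>f\<close> already takes its values in
      the ball.\<close>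
    let ?P = "closest_point (cball (0::'a) M)"
    have P: "continuous_on UNIV ?P" "\<And>x. norm (?P x) \<le> M" "\<And>x. norm x \<le> M \<Longrightarrow> ?P x = x"
      using \<open>0 \<le> M\<close> closest_point_in_set[of "cball (0::'a) M"]
      by (auto intro: continuous_on_closest_point closest_point_self)
    show ?thesis
    proof (rule closure_dominated_const)
      show "(\<lambda>s. ?P (g n s)) \<in> L2_closure" for n
        by (intro cont continuous_on_compose2[OF P(1) g]) auto
      show "f \<in> L2_space S"
        using M f by (intro L2_space_bounded_measurable[OF bounded_domain lebesgue_domain])
      have "AE s in lebesgue. s \<notin> N"
        using N by (intro AE_not_in) (simp add: negligible_iff_null_sets)
      then have "AE s in lebesgue. s \<in> S \<longrightarrow> (\<lambda>n. ?P (g n s)) \<longlonglongrightarrow> f s"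
      proof eventually_elim
        case (elim s)
        have "isCont ?P x" for x using P(1) by (simp add: continuous_on_eq_continuous_at)
        from isCont_tendsto_compose[OF this lim[OF elim]] M P(3)
        show ?case by auto
      qed
      then show "AE s in lebesgue_on S. (\<lambda>n. ?P (g n s)) \<longlonglongrightarrow> f s"
        using lebesgue_domain by (simp add: AE_restrict_space_iff)
      show "norm (?P (g n s)) \<le> M" for n s by (rule P)
    qed
  qed
  show "L2_space S \<subseteq> L2_closure"
  proof
    fix f :: "real \<Rightarrow> 'a" assume f: "f \<in> L2_space S"
    note [measurable] = L2_spaceD(1)[OF f]
    let ?f = "\<lambda>n s. if norm (f s) \<le> real n then f s else 0"
    show "f \<in> L2_closure"
    proof (rule closure_dominated[OF _ f _ f])
      show "?f n \<in> L2_closure" for n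
      proof (rule bdd[of _ "real n"])
        have "{s \<in> space (lebesgue_on S). norm (f s) \<le> real n} \<in> sets (lebesgue_on S)"
          by measurable
        then show "?f n \<in> borel_measurable (lebesgue_on S)"
          by (intro measurable_If) (use L2_spaceD(1)[OF f] in auto)
      qed auto
      have "(\<lambda>n. ?f n s) \<longlonglongrightarrow> f s" for s
      proof (rule tendsto_eventually)
        obtain k where "norm (f s) \<le> real k" using real_arch_simple by blast
        then show "eventually (\<lambda>n. ?f n s = f s) sequentially"
          by (intro eventually_sequentiallyI[of k]) auto
      qed
      then show "AE s in lebesgue_on S. (\<lambda>n. ?f n s) \<longlonglongrightarrow> f s" by simp
    qed auto
  qed
qed (auto intro: closure_subset_L2)

text \<open>Polynomials are combinations of powers of \<open>s - a\<close> with vector coefficients,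
  and Stone-Weierstrass approximates continuous functions by them uniformly on a compact set
  containing \<open>S\<close>.\<close>

lemma closure_eq_L2_if_powers:
  assumes pow: "\<And>n v. (\<lambda>s. (s - a) ^ n *\<^sub>R v) \<in> L2_closure"
  shows "L2_closure = L2_space S"
proof (rule closure_eq_L2_if_continuous)
  have poly: "p \<in> L2_closure" if p: "polynomial_function p" for p :: "real \<Rightarrow> 'a"
  proof -
    \<comment> \<open>Expanding the shifted polynomial \<open>p (s + a)\<close> in powers of
      \<open>s\<close> and substituting back \<open>s - a\<close> gives the expansion of
      \<open>p\<close> about \<open>a\<close>.\<close>
    have "polynomial_function (\<lambda>s::real. s + a)"
      by (intro polynomial_function_add polynomial_function_id polynomial_function_const)
    from polynomial_function_compose[OF this p]
    have "polynomial_function (\<lambda>s. p (s + a))" by (simp add: o_def)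
    then have "\<forall>b\<in>Basis. \<exists>c n. (\<lambda>s. p (s + a) \<bullet> b) = (\<lambda>s. \<Sum>i\<le>n. c i * s ^ i)"
      unfolding polynomial_function_iff_Basis_inner real_polynomial_function_iff_sum .
    then obtain c n where cn: "\<And>b. b \<in> Basis \<Longrightarrow> (\<lambda>s. p (s + a) \<bullet> b) = (\<lambda>s. \<Sum>i\<le>n b. c b i * s ^ i)"
      by metis
    have "p s \<bullet> b = (\<Sum>i\<le>n b. c b i * (s - a) ^ i)" if "b \<in> Basis" for s b
      using fun_cong[OF cn[OF that], of "s - a"] by simp
    then have "p s = (\<Sum>b\<in>Basis. \<Sum>i\<le>n b. c b i *\<^sub>R (s - a) ^ i *\<^sub>R b)" for s
      using euclidean_representation[of "p s"] by (simp add: scaleR_left.sum)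
    then have "p = (\<lambda>s. \<Sum>b\<in>Basis. \<Sum>i\<le>n b. c b i *\<^sub>R (s - a) ^ i *\<^sub>R b)" by auto
    also have "\<dots> \<in> L2_closure"
      by (intro closure_sum closure_scaleR pow)
    finally show ?thesis .
  qed
  fix f :: "real \<Rightarrow> 'a" assume f: "continuous_on UNIV f"
  \<comment> \<open>\<open>S\<close> itself need not be compact; a closed ball around it is, so the
    approximation takes place there.\<close>
  obtain R where "\<forall>s\<in>S. norm s \<le> R" using bounded_domain unfolding bounded_iff by blast
  then have R: "S \<subseteq> cball 0 R" by auto
  have cont: "continuous_on (cball 0 R) f" by (rule continuous_on_subset[OF f subset_UNIV])
  have "\<exists>p. polynomial_function p \<and> (\<forall>s\<in>cball 0 R. norm (f s - p s) < 1 / Suc n)" for n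
    by (rule Stone_Weierstrass_polynomial_function[OF compact_cball cont, of "1 / Suc n"]) auto
  then obtain p where p: "\<And>n. polynomial_function (p n)"
    "\<And>n s. s \<in> cball 0 R \<Longrightarrow> norm (f s - p n s) < 1 / Suc n"
    by metis
  have "bounded (f ` cball 0 R)"
    by (intro compact_imp_bounded compact_continuous_image cont compact_cball)
  then obtain K where K: "\<And>s. s \<in> cball 0 R \<Longrightarrow> norm (f s) \<le> K"
    unfolding bounded_iff by blast
  show "f \<in> L2_closure"
  proof (rule closure_dominated_const)
    show "p n \<in> L2_closure" for n by (rule poly[OF p(1)])
    have "f \<in> borel_measurable lebesgue"
      using borel_measurable_continuous_onI[OF f] by (simp add: measurable_completion)
    then have "f \<in> borel_measurable (lebesgue_on S)" by (rule measurable_restrict_space1)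
    then show "f \<in> L2_space S"
      using K R by (intro L2_space_bounded_measurable[OF bounded_domain lebesgue_domain]) blast+
    have "(\<lambda>n. p n s) \<longlonglongrightarrow> f s" if "s \<in> S" for s
    proof (rule Lim_transform_bound[THEN Lim_null[THEN iffD2]])
      show "eventually (\<lambda>n. norm (p n s - f s) \<le> norm (1 / real (Suc n))) sequentially"
        using p(2)[of s] that R by (intro always_eventually allI) (force simp: norm_minus_commute intro: less_imp_le)
      show "(\<lambda>n. 1 / real (Suc n)) \<longlonglongrightarrow> 0" by (rule LIMSEQ_Suc[OF lim_1_over_n])
    qed
    then show "AE s in lebesgue_on S. (\<lambda>n. p n s) \<longlonglongrightarrow> f s"
      by (intro AE_I2) simp
    show "norm (p n s) \<le> K + 1" if "s \<in> S" for n s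
    proof -
      have s: "s \<in> cball 0 R" using R that by blast
      have "norm (p n s) \<le> norm (f s) + norm (f s - p n s)"
        using norm_triangle_ineq4[of "f s" "f s - p n s"] by simp
      moreover have "1 / real (Suc n) \<le> 1" by simp
      ultimately show ?thesis using K[OF s] p(2)[OF s, of n] by linarith
    qed
  qed
qed

end

section \<open>Primitives\<close>

definition zero_extension :: "real set \<Rightarrow> (real \<Rightarrow> 'a::euclidean_space) \<Rightarrow> real \<Rightarrow> 'a" where
  "zero_extension S f r = (if r \<in> S then f r else 0)"

text \<open>Starting the integral at minus infinity makes the operator commute with translations,
  hence with delays. On a zero extension from \<open>{a<..<b}\<close> it is the usual integral from
  \<open>a\<close>.\<close>

definition primitive :: "(real \<Rightarrow> 'a::euclidean_space) \<Rightarrow> real \<Rightarrow> 'a" where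
  "primitive f t = (LINT r|lebesgue. (if r \<le> t then f r else 0))"

lemma AE_lebesgue_neq: "AE r in lebesgue. r \<noteq> (t::real)"
  using AE_not_in[of "{t}" lebesgue] by (simp add: negligible_iff_null_sets[symmetric])

lemma zero_extension_integrable:
  fixes f :: "real \<Rightarrow> 'a::euclidean_space"
  assumes "bounded S" "S \<in> sets lebesgue" "f \<in> L2_space S"
  shows "integrable lebesgue (zero_extension S f)"
  using L2_space_integrable[OF assms] Lebesgue_Measure.integrable_restrict_UNIV[OF assms(2), of f]
  by (simp add: zero_extension_def[abs_def])

lemma primitive_integrable:
  fixes f :: "real \<Rightarrow> 'a::euclidean_space"
  assumes "integrable lebesgue f"
  shows "integrable lebesgue (\<lambda>r. if r \<le> t then f r else 0)"
proof -
  have "integrable lebesgue (\<lambda>r. indicator {..t} r *\<^sub>R f r)"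
    using integrable_mult_indicator[of "{..t}" lebesgue f] assms by simp
  then show ?thesis by (simp add: indicator_scaleR_eq_if)
qed

lemma primitive_add:
  assumes "integrable lebesgue f" "integrable lebesgue g"
  shows "primitive (\<lambda>r. f r + g r) t = primitive f t + primitive g t"
proof -
  have "primitive (\<lambda>r. f r + g r) t = (LINT r|lebesgue. (if r \<le> t then f r else 0) + (if r \<le> t then g r else 0))"
    unfolding primitive_def by (intro Bochner_Integration.integral_cong) auto
  then show ?thesis
    using primitive_integrable[OF assms(1), of t] primitive_integrable[OF assms(2), of t]
    by (simp add: primitive_def)
qed

lemma primitive_bounded_linear:
  assumes "integrable lebesgue f" "bounded_linear h"
  shows "primitive (\<lambda>r. h (f r)) t = h (primitive f t)"
proof -
  interpret bounded_linear h by (fact assms(2))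
  have "primitive (\<lambda>r. h (f r)) t = (LINT r|lebesgue. h (if r \<le> t then f r else 0))"
    unfolding primitive_def by (intro Bochner_Integration.integral_cong) (auto simp: zero)
  then show ?thesis
    using integral_bounded_linear[OF assms(2) primitive_integrable[OF assms(1)]]
    by (simp add: primitive_def)
qed

lemma primitive_sum:
  assumes "\<And>i. i \<in> I \<Longrightarrow> integrable lebesgue (f i)"
  shows "primitive (\<lambda>r. \<Sum>i\<in>I. f i r) t = (\<Sum>i\<in>I. primitive (f i) t)"
  using assms
  by (induction I rule: infinite_finite_induct) (auto simp: primitive_add Bochner_Integration.integrable_sum, auto simp: primitive_def)

lemma primitive_diff:
  assumes "integrable lebesgue f" "integrable lebesgue g"
  shows "primitive (\<lambda>r. f r - g r) t = primitive f t - primitive g t"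
  using primitive_add[OF assms(1), of "\<lambda>r. - g r"] assms(2)
    primitive_bounded_linear[OF assms(2) bounded_linear_minus[OF bounded_linear_ident]] by simp

lemma primitive_shift:
  "primitive (\<lambda>r. f (r - c)) t = primitive f (t - c)"
  using lebesgue_integral_real_affine[of 1 "\<lambda>r. if r \<le> t then f (r - c) else 0" c]
  by (simp add: primitive_def le_diff_eq add.commute cong: if_cong)

lemma integrable_shift:
  fixes f :: "real \<Rightarrow> 'a::euclidean_space"
  shows "integrable lebesgue f \<Longrightarrow> integrable lebesgue (\<lambda>r. f (r - c))"
  using lebesgue_integrable_real_affine_iff[of 1 f "-c"] by simp

lemma norm_primitive_le:
  assumes "integrable lebesgue f"
  shows "norm (primitive f t) \<le> (LINT r|lebesgue. norm (f r))"
proof -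
  have "norm (primitive f t) \<le> (LINT r|lebesgue. norm (if r \<le> t then f r else 0))"
    unfolding primitive_def by (rule integral_norm_bound)
  also have "\<dots> \<le> (LINT r|lebesgue. norm (f r))"
    using primitive_integrable[OF assms] assms by (intro integral_mono) auto
  finally show ?thesis .
qed

text \<open>Agreement strictly before \<open>t\<close> suffices, since a single point is null. This
  permits \<open>t = T\<close>, although the equation is known only before \<open>T\<close>.\<close>

lemma primitive_AE_cong:
  assumes "integrable lebesgue f" "integrable lebesgue g" "AE r in lebesgue. r < t \<longrightarrow> f r = g r"
  shows "primitive f t = primitive g t"
  unfolding primitive_def
proof (rule integral_cong_AE)
  have "AE r in lebesgue. r \<noteq> t"
    by (rule AE_lebesgue_neq)
  with assms(3) show "AE r in lebesgue. (if r \<le> t then f r else 0) = (if r \<le> t then g r else 0)"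
    by eventually_elim auto
qed (intro borel_measurable_integrable primitive_integrable assms)+

text \<open>Dominated convergence with bound \<open>norm (f r)\<close>: for every \<open>r\<close>
  other than \<open>t\<close>, the truncated integrand is eventually constant along the
  sequence.\<close>

lemma continuous_on_primitive:
  assumes f: "integrable lebesgue f"
  shows "continuous_on UNIV (primitive f)"
  unfolding continuous_on_sequentially comp_def
proof (intro ballI allI impI, elim conjE)
  fix u :: "nat \<Rightarrow> real" and t assume u: "u \<longlonglongrightarrow> t"
  show "(\<lambda>n. primitive f (u n)) \<longlonglongrightarrow> primitive f t"
    unfolding primitive_def
  proof (rule integral_dominated_convergence)
    have "AE r in lebesgue. r \<noteq> t"
      by (rule AE_lebesgue_neq)
    then show "AE r in lebesgue. (\<lambda>n. if r \<le> u n then f r else 0) \<longlonglongrightarrow> (if r \<le> t then f r else 0)"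
    proof eventually_elim
      case (elim r)
      show ?case
      proof (rule tendsto_eventually, cases "r < t")
        case True
        with order_tendstoD(1)[OF u] have "eventually (\<lambda>n. r < u n) sequentially" by blast
        then show "eventually (\<lambda>n. (if r \<le> u n then f r else 0) = (if r \<le> t then f r else 0)) sequentially"
          by (rule eventually_mono) (use True in auto)
      next
        case False
        with elim have "t < r" by simp
        with order_tendstoD(2)[OF u] have "eventually (\<lambda>n. u n < r) sequentially" by blast
        then show "eventually (\<lambda>n. (if r \<le> u n then f r else 0) = (if r \<le> t then f r else 0)) sequentially"
          by (rule eventually_mono) (use \<open>t < r\<close> in auto)
      qed
    qed
    show "integrable lebesgue (\<lambda>r. norm (f r))" using f by simp
  qed (use primitive_integrable[OF f] in auto)
qed

lemma primitive_in_L2: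
  assumes "integrable lebesgue f" "bounded S" "S \<in> sets lebesgue"
  shows "primitive f \<in> L2_space S"
proof (rule L2_space_bounded_measurable[OF assms(2,3)])
  have "primitive f \<in> borel_measurable lebesgue"
    using borel_measurable_continuous_onI[OF continuous_on_primitive[OF assms(1)]]
    by (simp add: measurable_completion)
  then show "primitive f \<in> borel_measurable (lebesgue_on S)" by (rule measurable_restrict_space1)
  show "norm (primitive f s) \<le> (LINT r|lebesgue. norm (f r))" for s
    by (rule norm_primitive_le[OF assms(1)])
qed

lemma primitive_power:
  fixes v :: "'a::euclidean_space"
  assumes "a < s" "s < b"
  shows "primitive (zero_extension {a<..<b} (\<lambda>r. (r - a) ^ n *\<^sub>R v)) s = (s - a) ^ Suc n *\<^sub>R (v /\<^sub>R Suc n)"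
proof -
  let ?f = "\<lambda>r. (r - a) ^ n *\<^sub>R v"
  have "integral\<^sup>L lborel (\<lambda>r. indicator {a..s} r *\<^sub>R ?f r) =
      (s - a) ^ Suc n *\<^sub>R (v /\<^sub>R Suc n) - (a - a) ^ Suc n *\<^sub>R (v /\<^sub>R Suc n)"
  proof (rule integral_FTC_atLeastAtMost)
    fix x :: real
    have "((\<lambda>x. (x - a) ^ Suc n) has_real_derivative real (Suc n) * (x - a) ^ n) (at x within {a..s})"
      by (rule DERIV_cong[OF DERIV_power[OF DERIV_diff[OF DERIV_ident DERIV_const]]]) simp
    then have "((\<lambda>x. (x - a) ^ Suc n *\<^sub>R (v /\<^sub>R Suc n)) has_vector_derivative (real (Suc n) * (x - a) ^ n) *\<^sub>R (v /\<^sub>R Suc n)) (at x within {a..s})"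
      by (intro has_vector_derivative_scaleR[OF _ has_vector_derivative_const, simplified])
    moreover have "real (Suc n) * (x - a) ^ n * inverse (real (Suc n)) = (x - a) ^ n"
      by (simp add: field_simps)
    ultimately show "((\<lambda>x. (x - a) ^ Suc n *\<^sub>R (v /\<^sub>R Suc n)) has_vector_derivative ?f x) (at x within {a..s})"
      by (simp only: scaleR_scaleR)
  qed (use assms in \<open>auto intro!: continuous_intros\<close>)
  moreover have "integral\<^sup>L lborel (\<lambda>r. indicator {a..s} r *\<^sub>R ?f r) = integral\<^sup>L lebesgue (\<lambda>r. indicator {a..s} r *\<^sub>R ?f r)"
    by (rule integral_completion[symmetric]) simp
  moreover have "integral\<^sup>L lebesgue (\<lambda>r. indicator {a..s} r *\<^sub>R ?f r) =
      primitive (zero_extension {a<..<b} ?f) s"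
    unfolding primitive_def
  proof (rule integral_cong_AE)
    show "(\<lambda>r. indicator {a..s} r *\<^sub>R ?f r) \<in> borel_measurable lebesgue"
      by (rule measurable_completion) simp
    have "(\<lambda>r. indicator {a<..s} r *\<^sub>R ?f r) \<in> borel_measurable lebesgue"
      by (rule measurable_completion) simp
    moreover have "(\<lambda>r. indicator {a<..s} r *\<^sub>R ?f r) = (\<lambda>r. if r \<le> s then zero_extension {a<..<b} ?f r else 0)"
      using assms by (auto simp: fun_eq_iff zero_extension_def indicator_def)
    ultimately show "(\<lambda>r. if r \<le> s then zero_extension {a<..<b} ?f r else 0) \<in> borel_measurable lebesgue"
      by simp
    have "AE r in lebesgue. r \<noteq> a"
      by (rule AE_lebesgue_neq)
    then show "AE r in lebesgue. indicator {a..s} r *\<^sub>R ?f r = (if r \<le> s then zero_extension {a<..<b} ?f r else 0)"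
      by eventually_elim (use assms in \<open>auto simp: zero_extension_def indicator_def\<close>)
  qed
  ultimately show ?thesis by simp
qed

text \<open>Integrating a window of \<open>x\<close> from its left end loses everything accumulated
  before. The subtracted term is the constant that controllability to constants has to
  compensate.\<close>

lemma primitive_window:
  assumes "integrable lebesgue x" "a < s" "s < b"
  shows "primitive (zero_extension {a<..<b} (\<lambda>r. x (T + r))) s = primitive x (T + s) - primitive x (T + a)"
proof -
  have int: "integrable lebesgue (\<lambda>r. x (T + r))"
    using lebesgue_integrable_real_affine_iff[of 1 x T] assms(1) by simp
  have "primitive (zero_extension {a<..<b} (\<lambda>r. x (T + r))) s =
    (LINT r|lebesgue. (if r \<le> s then x (T + r) else 0) - (if r \<le> a then x (T + r) else 0))"
    unfolding primitive_def
  proof (rule integral_cong_AE)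
    show "(\<lambda>r. (if r \<le> s then x (T + r) else 0) - (if r \<le> a then x (T + r) else 0)) \<in> borel_measurable lebesgue"
      using primitive_integrable[OF int, of s] primitive_integrable[OF int, of a] by measurable
    have eq: "(\<lambda>r. if r \<le> s then zero_extension {a<..<b} (\<lambda>r. x (T + r)) r else 0) = (\<lambda>r. indicator {a<..s} r *\<^sub>R x (T + r))"
      using assms by (auto simp: fun_eq_iff zero_extension_def indicator_def)
    show "(\<lambda>r. if r \<le> s then zero_extension {a<..<b} (\<lambda>r. x (T + r)) r else 0) \<in> borel_measurable lebesgue"
      unfolding eq using integrable_mult_indicator[of "{a<..s}" lebesgue "\<lambda>r. x (T + r)"] int by simp
    show "AE r in lebesgue. (if r \<le> s then zero_extension {a<..<b} (\<lambda>r. x (T + r)) r else 0) =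
       (if r \<le> s then x (T + r) else 0) - (if r \<le> a then x (T + r) else 0)"
      using assms by (intro AE_I2) (auto simp: zero_extension_def)
  qed
  also have "\<dots> = primitive (\<lambda>r. x (T + r)) s - primitive (\<lambda>r. x (T + r)) a"
    unfolding primitive_def
    by (rule Bochner_Integration.integral_diff) (rule primitive_integrable[OF int])+
  also have "\<dots> = primitive x (T + s) - primitive x (T + a)"
    using primitive_shift[of x "-T"] by (simp add: add.commute)
  finally show ?thesis .
qed

section \<open>Stability of the closure under integration\<close>

context L2_subspace begin

lemma closure_cong:
  assumes "y \<in> L2_closure" "\<And>s. s \<in> S \<Longrightarrow> y s = y' s"
  shows "y' \<in> L2_closure"
proof (rule closure_closed)
  show "y' \<in> L2_space S"
    using assms lebesgue_domain by (intro L2_space_AE_cong[OF closure_subset_L2[OF assms(1)]]) (auto intro: AE_I2)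
  have "sqdist y y' = (LINT s|lebesgue_on S. 0)"
    unfolding sqdist_def by (rule Bochner_Integration.integral_cong) (auto simp: assms(2))
  then show "\<exists>z\<in>L2_closure. sqdist z y' < \<epsilon>" if "\<epsilon> > 0" for \<epsilon>
    using that by (intro bexI[OF _ assms(1)]) simp
qed

text \<open>If \<open>w\<close> in \<open>W\<close> is close to \<open>y\<close>, then the
  primitives are uniformly close by the L1 estimate. The primitive of \<open>w\<close> lies in the
  closure because it differs from a member of \<open>W\<close> by a constant.\<close>

lemma closure_primitive:
  assumes const: "\<And>v. (\<lambda>s. v) \<in> L2_closure"
    and prim: "\<And>w. w \<in> W \<Longrightarrow> \<exists>w'\<in>W. \<exists>c. \<forall>s\<in>S. w' s = c + primitive (zero_extension S w) s"
    and y: "y \<in> L2_closure"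
  shows "primitive (zero_extension S y) \<in> L2_closure"
proof (rule closure_closed)
  note dom = bounded_domain lebesgue_domain
  have yL2: "y \<in> L2_space S" by (rule closure_subset_L2[OF y])
  show "primitive (zero_extension S y) \<in> L2_space S"
    by (intro primitive_in_L2 zero_extension_integrable dom yL2)
  fix \<epsilon> :: real assume \<epsilon>: "\<epsilon> > 0"
  define \<mu> where "\<mu> = measure lebesgue S"
  \<comment> \<open>With \<open>sqdist w y < \<eta>\<^sup>2\<close>, the L1 estimate of weight
    \<open>\<eta>\<close> bounds the primitive of \<open>w - y\<close> by
    \<open>\<eta> * ((\<mu> + 1) / 2)\<close>. Squaring and integrating over \<open>S\<close> gives
    \<open>K * \<eta>\<^sup>2\<close>, and \<open>\<eta>\<close> is chosen so that
    \<open>(K + 1) * \<eta>\<^sup>2 = \<epsilon>\<close>.\<close>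
  define K where "K = \<mu> * ((\<mu> + 1) / 2)\<^sup>2"
  define \<eta> where "\<eta> = sqrt (\<epsilon> / (K + 1))"
  have "0 \<le> \<mu>" by (simp add: \<mu>_def)
  then have "0 \<le> K" by (simp add: K_def)
  with \<epsilon> have \<eta>: "\<eta> > 0" "\<eta>\<^sup>2 = \<epsilon> / (K + 1)" by (simp_all add: \<eta>_def)
  obtain w where w: "w \<in> W" "w \<in> L2_space S" "sqdist w y < \<eta>\<^sup>2"
    using closure_approx[OF y, of "\<eta>\<^sup>2"] \<eta>(1) by auto
  obtain w' c where w': "w' \<in> W" "\<And>s. s \<in> S \<Longrightarrow> w' s = c + primitive (zero_extension S w) s"
    using prim[OF w(1)] by auto
  \<comment> \<open>The correction by \<open>- c\<close> leaves \<open>W\<close> but stays in the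
    closure, by \<open>const\<close>.\<close>
  let ?z = "\<lambda>s. w' s + (- c)"
  have z: "?z \<in> L2_closure"
    by (rule closure_add[OF mem_closure[OF w'(1)] const])
  let ?d = "\<lambda>s. w s - y s"
  have d: "?d \<in> L2_space S" by (rule L2_space_diff[OF w(2) yL2])
  have "zero_extension S ?d = (\<lambda>r. zero_extension S w r - zero_extension S y r)"
    by (auto simp: zero_extension_def fun_eq_iff)
  then have diff: "primitive (zero_extension S ?d) s = primitive (zero_extension S w) s - primitive (zero_extension S y) s" for s
    by (simp add: primitive_diff zero_extension_integrable[OF dom] w(2) yL2)
  have bound: "norm (primitive (zero_extension S ?d) s) \<le> \<eta> * ((\<mu> + 1) / 2)" for s
  proof -
    have "norm (primitive (zero_extension S ?d) s) \<le> (LINT r|lebesgue. norm (zero_extension S ?d r))"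
      by (intro norm_primitive_le zero_extension_integrable dom d)
    also have "(\<lambda>r. norm (zero_extension S ?d r)) = (\<lambda>r. if r \<in> S then norm (?d r) else 0)"
      by (auto simp: zero_extension_def)
    also have "(LINT r|lebesgue. (if r \<in> S then norm (?d r) else 0)) = (LINT r|lebesgue_on S. norm (?d r))"
      by (rule Lebesgue_Measure.integral_restrict_UNIV[OF lebesgue_domain])
    also have "\<dots> \<le> (\<eta> * \<mu> + sqdist w y / \<eta>) / 2"
      using L1_le_L2[OF dom d \<eta>(1)] by (simp add: \<mu>_def sqdist_def)
    also have "\<dots> \<le> (\<eta> * \<mu> + \<eta>) / 2"
      using w(3) \<eta>(1) by (simp add: field_simps power2_eq_square)
    finally show ?thesis by (simp add: algebra_simps)
  qed
  interpret finite_measure "lebesgue_on S" by (rule finite_measure_lebesgue_on_bounded[OF dom])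
  have "sqdist ?z (primitive (zero_extension S y)) = (LINT s|lebesgue_on S. (norm (primitive (zero_extension S ?d) s))\<^sup>2)"
    unfolding sqdist_def by (rule Bochner_Integration.integral_cong) (auto simp: w'(2) diff)
  also have "\<dots> \<le> (LINT s|lebesgue_on S. (\<eta> * ((\<mu> + 1) / 2))\<^sup>2)"
  proof (rule integral_mono)
    show "integrable (lebesgue_on S) (\<lambda>s. (norm (primitive (zero_extension S ?d) s))\<^sup>2)"
      by (intro L2_spaceD(2) primitive_in_L2 zero_extension_integrable dom d)
    show "(norm (primitive (zero_extension S ?d) s))\<^sup>2 \<le> (\<eta> * ((\<mu> + 1) / 2))\<^sup>2" for s
      by (rule power_mono[OF bound norm_ge_zero])
  qed simp
  also have "\<dots> = K * \<eta>\<^sup>2"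
    using lebesgue_domain by (simp add: measure_restrict_space space_restrict_space K_def \<mu>_def power2_eq_square)
  also have "\<dots> < K * \<eta>\<^sup>2 + \<eta>\<^sup>2"
    using \<eta>(1) by simp
  also have "\<dots> = \<epsilon>"
    using \<eta>(2) \<open>0 \<le> K\<close> by (simp add: field_simps)
  finally show "\<exists>z\<in>L2_closure. sqdist z (primitive (zero_extension S y)) < \<epsilon>"
    using z by blast
qed

lemma closure_eq_L2_if_primitive:
  assumes S: "S = {a<..<b}" and const: "\<And>v. (\<lambda>s. v) \<in> L2_closure"
    and prim: "\<And>w. w \<in> W \<Longrightarrow> \<exists>w'\<in>W. \<exists>c. \<forall>s\<in>S. w' s = c + primitive (zero_extension S w) s"
  shows "L2_closure = L2_space S"
proof (rule closure_eq_L2_if_powers)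
  show "(\<lambda>s. (s - a) ^ n *\<^sub>R v) \<in> L2_closure" for n v
  proof (induction n arbitrary: v)
    case (Suc n)
    \<comment> \<open>The factor \<open>Suc n\<close> cancels the division produced by integrating
      the power.\<close>
    let ?f = "\<lambda>r. (r - a) ^ n *\<^sub>R (real (Suc n) *\<^sub>R v)"
    have "primitive (zero_extension S ?f) \<in> L2_closure"
      by (rule closure_primitive[OF const prim Suc.IH])
    then show ?case
    proof (rule closure_cong)
      show "primitive (zero_extension S ?f) s = (s - a) ^ Suc n *\<^sub>R v" if "s \<in> S" for s
        using primitive_power[of a s b n "real (Suc n) *\<^sub>R v"] that by (simp add: S)
    qed
  qed (simp add: const)
qed

end

section \<open>The difference equation\<close>

lemma AE_lebesgue_translate:
  fixes c :: real
  assumes "AE s in lebesgue. P s"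
  shows "AE r in lebesgue. P (c + r)"
proof (rule AE_distrD[where f="\<lambda>r. c + r" and M'=lebesgue and P=P])
  show "(\<lambda>r. c + r) \<in> lebesgue \<rightarrow>\<^sub>M lebesgue"
    using lebesgue_affine_measurable[where c="\<lambda>_::real. 1" and t=c] by simp
  have eq: "distr lebesgue lebesgue (\<lambda>r. c + r) = lebesgue"
    using lebesgue_real_affine[of 1 c] by (simp add: density_1)
  show "AE s in distr lebesgue lebesgue (\<lambda>r. c + r). P s"
    unfolding eq by (fact assms)
qed

lemma L2_norm_less_iff:
  assumes "\<epsilon> > 0"
  shows "L2_norm S f < \<epsilon> \<longleftrightarrow> (LINT s|lebesgue_on S. (norm (f s))\<^sup>2) < \<epsilon>\<^sup>2"
proof -
  have "L2_norm S f < \<epsilon> \<longleftrightarrow> L2_norm S f < sqrt (\<epsilon>\<^sup>2)" using assms by simp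
  then show ?thesis unfolding L2_norm_def real_sqrt_less_iff .
qed

locale difference_equation =
  fixes N :: nat and A :: "nat \<Rightarrow> complex^'d^'d" and B :: "complex^'m^'d"
    and \<Lambda> :: "nat \<Rightarrow> real" and T :: real
  assumes N_pos: "N \<ge> 1" and delay_pos: "\<And>j. j \<in> {1..N} \<Longrightarrow> \<Lambda> j > 0" and T_pos: "T > 0"
begin

text \<open>The step length of the method of steps: over a time span of this length, the delayed
  terms involve only values that are already known.\<close>

definition min_delay :: real where "min_delay = Min (\<Lambda> ` {1..N})"

lemma delay_bounds:
  assumes "j \<in> {1..N}"
  shows "\<Lambda> j \<le> max_delay N \<Lambda>" "min_delay \<le> \<Lambda> j"
  using assms by (auto simp: max_delay_def min_delay_def)

lemma min_delay_pos: "min_delay > 0"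
proof -
  have "min_delay \<in> \<Lambda> ` {1..N}"
    unfolding min_delay_def using N_pos by (intro Min_in) auto
  then show ?thesis using delay_pos by auto
qed

lemma max_delay_pos: "max_delay N \<Lambda> > 0"
  using delay_bounds[of 1] delay_pos[of 1] N_pos by auto

lemma exists_multiple_min_delay: "\<exists>k. T \<le> real k * min_delay"
  using reals_Archimedean3[OF min_delay_pos] less_imp_le by blast

lemma history_interval_domain:
  "bounded (history_interval N \<Lambda>)" "history_interval N \<Lambda> \<in> sets lebesgue"
  by (simp_all add: history_interval_def)

section \<open>Superposition, existence and square-integrability of solutions\<close>

lemma is_solution_add:
  assumes "is_solution N A B \<Lambda> T x0 u x" "is_solution N A B \<Lambda> T x0' u' x'"
  shows "is_solution N A B \<Lambda> T (\<lambda>s. x0 s + x0' s) (\<lambda>s. u s + u' s) (\<lambda>s. x s + x' s)"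
  unfolding is_solution_def
proof
  have "AE s in lebesgue_on (history_interval N \<Lambda>). x s = x0 s"
    "AE s in lebesgue_on (history_interval N \<Lambda>). x' s = x0' s"
    using assms by (simp_all add: is_solution_def)
  then show "AE s in lebesgue_on (history_interval N \<Lambda>). x s + x' s = x0 s + x0' s"
    by eventually_elim simp
  have "AE t in lebesgue_on {0<..<T}. x t = (\<Sum>j=1..N. A j *v x (t - \<Lambda> j)) + B *v u t"
    "AE t in lebesgue_on {0<..<T}. x' t = (\<Sum>j=1..N. A j *v x' (t - \<Lambda> j)) + B *v u' t"
    using assms by (simp_all add: is_solution_def)
  then show "AE t in lebesgue_on {0<..<T}.
      x t + x' t = (\<Sum>j=1..N. A j *v (x (t - \<Lambda> j) + x' (t - \<Lambda> j))) + B *v (u t + u' t)"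
    by eventually_elim (simp add: matrix_vector_right_distrib sum.distrib)
qed

lemma is_solution_scaleR:
  assumes "is_solution N A B \<Lambda> T x0 u x"
  shows "is_solution N A B \<Lambda> T (\<lambda>s. c *\<^sub>R x0 s) (\<lambda>s. c *\<^sub>R u s) (\<lambda>s. c *\<^sub>R x s)"
  unfolding is_solution_def
proof
  have scale: "M *v (c *\<^sub>R v) = c *\<^sub>R (M *v v)" for M :: "complex^'n^'k" and v
    by (rule linear_scale[OF bounded_linear.linear[OF matrix_vector_mul_bounded_linear]])
  have "AE s in lebesgue_on (history_interval N \<Lambda>). x s = x0 s"
    using assms by (simp add: is_solution_def)
  then show "AE s in lebesgue_on (history_interval N \<Lambda>). c *\<^sub>R x s = c *\<^sub>R x0 s"
    by eventually_elim simp
  have "AE t in lebesgue_on {0<..<T}. x t = (\<Sum>j=1..N. A j *v x (t - \<Lambda> j)) + B *v u t"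
    using assms by (simp add: is_solution_def)
  then show "AE t in lebesgue_on {0<..<T}.
      c *\<^sub>R x t = (\<Sum>j=1..N. A j *v (c *\<^sub>R x (t - \<Lambda> j))) + B *v (c *\<^sub>R u t)"
    by eventually_elim (simp add: scale scaleR_right_distrib scaleR_right.sum)
qed

text \<open>Method of steps. The construction is pointwise and needs no regularity of
  \<open>x0\<close> or \<open>u\<close>; square-integrability is a separate matter.\<close>

lemma exists_solution: "\<exists>x. is_solution N A B \<Lambda> T x0 u x"
proof -
  define rhs where "rhs x t = (\<Sum>j=1..N. A j *v x (t - \<Lambda> j)) + B *v u t" for x t
  have "\<exists>x. (\<forall>t\<le>0. x t = x0 t) \<and> (\<forall>t. 0 < t \<and> t \<le> real k * min_delay \<longrightarrow> x t = rhs x t)" for k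
  proof (induction k)
    case 0
    then show ?case by (intro exI[of _ x0]) auto
  next
    case (Suc k)
    then obtain x where x: "\<And>t. t \<le> 0 \<Longrightarrow> x t = x0 t"
      "\<And>t. 0 < t \<Longrightarrow> t \<le> real k * min_delay \<Longrightarrow> x t = rhs x t" by blast
    \<comment> \<open>For \<open>t \<le> real (Suc k) * min_delay\<close>, every
      \<open>t - \<Lambda> j\<close> is at most \<open>real k * min_delay\<close>, where
      \<open>x'\<close> and \<open>x\<close> agree. Later values of \<open>x'\<close> are
      provisional and get replaced in the next step.\<close>
    define x' where "x' t = (if t \<le> real k * min_delay then x t else rhs x t)" for t
    have nonneg: "0 \<le> real k * min_delay" using min_delay_pos by simp
    have "rhs x' t = rhs x t" if "t \<le> real (Suc k) * min_delay" for t
    proof -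
      have "x' (t - \<Lambda> j) = x (t - \<Lambda> j)" if j: "j \<in> {1..N}" for j
        using \<open>t \<le> _\<close> delay_bounds(2)[OF j] by (simp add: x'_def algebra_simps)
      then show ?thesis by (simp add: rhs_def)
    qed
    then have "\<forall>t. 0 < t \<and> t \<le> real (Suc k) * min_delay \<longrightarrow> x' t = rhs x' t"
      using x(2) by (simp add: x'_def)
    moreover have "\<forall>t\<le>0. x' t = x0 t"
      using x(1) nonneg by (auto simp: x'_def)
    ultimately show ?case by blast
  qed
  moreover obtain k where k: "T \<le> real k * min_delay" using exists_multiple_min_delay by blast
  ultimately obtain x where x: "\<And>t. t \<le> 0 \<Longrightarrow> x t = x0 t"
    "\<And>t. 0 < t \<Longrightarrow> t \<le> real k * min_delay \<Longrightarrow> x t = rhs x t" by blast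
  have "is_solution N A B \<Lambda> T x0 u x"
    unfolding is_solution_def
    using k by (auto simp: history_interval_def x(1) x(2)[unfolded rhs_def] intro!: AE_I2)
  then show ?thesis by blast
qed

text \<open>The method of steps again, now for an arbitrary solution: each step expresses
  \<open>x\<close> almost everywhere by translates of \<open>x\<close> from the known range and by
  \<open>u\<close>.\<close>

lemma solution_in_L2:
  assumes sol: "is_solution N A B \<Lambda> T x0 u x"
    and x0: "x0 \<in> state_space N \<Lambda>" and u: "u \<in> control_space T"
  shows "x \<in> L2_space {- max_delay N \<Lambda><..<T}"
proof -
  define L where "L = max_delay N \<Lambda>"
  have hist: "x \<in> L2_space {-L<..<0}"
  proof (rule L2_space_AE_cong)
    show "x0 \<in> L2_space {-L<..<0}"
      using x0 by (simp add: state_space_def history_interval_def L_def)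
    have "AE s in lebesgue_on {-L<..<0}. x s = x0 s"
      using sol unfolding is_solution_def history_interval_def L_def by blast
    then show "AE s in lebesgue_on {-L<..<0}. x0 s = x s" by eventually_elim simp
  qed simp
  have eq: "AE t in lebesgue. t \<in> {0<..<T} \<longrightarrow> x t = (\<Sum>j=1..N. A j *v x (t - \<Lambda> j)) + B *v u t"
    using sol by (simp add: is_solution_def AE_restrict_space_iff)
  \<comment> \<open>The horizon is cut at \<open>T\<close>, beyond which a solution is
    unconstrained.\<close>
  have "x \<in> L2_space {-L<..<min T (real k * min_delay)}" for k
  proof (induction k)
    case 0
    then show ?case using hist T_pos by simp
  next
    case (Suc k)
    define b where "b = min T (real k * min_delay)"
    define b' where "b' = min T (real (Suc k) * min_delay)"
    have "0 < real (Suc k) * min_delay" using min_delay_pos by simp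
    with T_pos have "0 < b'" by (simp only: b'_def min_less_iff_conj)
    moreover have "b' \<le> T" "b' \<le> b + min_delay"
      using min_delay_pos by (auto simp: b_def b'_def min_def algebra_simps)
    ultimately have b': "0 < b'" "b' \<le> T" "b' \<le> b + min_delay" .
    have "(\<lambda>t. x (t - \<Lambda> j)) \<in> L2_space {0<..<b'}" if j: "j \<in> {1..N}" for j
    proof (rule L2_space_subset)
      show "(\<lambda>t. x (t - \<Lambda> j)) \<in> L2_space {- L - (- \<Lambda> j)<..<b - (- \<Lambda> j)}"
        using L2_space_translate[of x "-L" b "- \<Lambda> j"] Suc.IH by (simp add: b_def add.commute)
      show "{0<..<b'} \<subseteq> {- L - (- \<Lambda> j)<..<b - (- \<Lambda> j)}"
        using delay_bounds[OF j] b' by (auto simp: L_def)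
    qed auto
    moreover have "u \<in> L2_space {0<..<b'}"
      by (rule L2_space_subset[of u "{0<..<T}"]) (use u b' in \<open>auto simp: control_space_def\<close>)
    ultimately have "(\<lambda>t. (\<Sum>j=1..N. A j *v x (t - \<Lambda> j)) + B *v u t) \<in> L2_space {0<..<b'}"
      by (intro L2_space_add L2_space_sum L2_space_bounded_linear[OF _ matrix_vector_mul_bounded_linear])
    moreover have "AE t in lebesgue_on {0<..<b'}. (\<Sum>j=1..N. A j *v x (t - \<Lambda> j)) + B *v u t = x t"
      using eq b' by (auto simp: AE_restrict_space_iff elim!: eventually_mono)
    ultimately have "x \<in> L2_space {0<..<b'}"
      by (rule L2_space_AE_cong) simp
    \<comment> \<open>Neither the initial condition nor the equation says anything at time 0; this
      null point joins the two intervals.\<close>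
    moreover have "x \<in> L2_space {0}"
      by (rule L2_space_null) (simp add: negligible_iff_null_sets[symmetric])
    ultimately have "x \<in> L2_space ({-L<..<0} \<union> ({0} \<union> {0<..<b'}))"
      by (intro L2_space_Un hist) auto
    moreover have "{-L<..<0} \<union> ({0} \<union> {0<..<b'}) = {-L<..<b'}"
      using b'(1) max_delay_pos by (auto simp: L_def)
    ultimately show ?case by (simp add: b'_def)
  qed
  moreover obtain k where "T \<le> real k * min_delay" using exists_multiple_min_delay by blast
  ultimately show ?thesis by (metis L_def min.absorb1)
qed

lemma history_in_state_space:
  assumes "is_solution N A B \<Lambda> T x0 u x" "x0 \<in> state_space N \<Lambda>" "u \<in> control_space T"
  shows "history x T \<in> state_space N \<Lambda>"
proof -
  have "(\<lambda>s. x (T + s)) \<in> L2_space {- max_delay N \<Lambda> - T<..<T - T}"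
    by (rule L2_space_translate[OF solution_in_L2[OF assms]])
  then show ?thesis
    unfolding history_def state_space_def history_interval_def
    by (rule L2_space_subset) (use T_pos in auto)
qed

section \<open>The states reachable from zero and their primitives\<close>

definition reachable :: "(real \<Rightarrow> complex^'d) set" where
  "reachable = {w. \<exists>u\<in>control_space T. \<exists>x. is_solution N A B \<Lambda> T (\<lambda>_. 0) u x \<and> w = history x T}"

lemma reachableI:
  "u \<in> control_space T \<Longrightarrow> is_solution N A B \<Lambda> T (\<lambda>_. 0) u x \<Longrightarrow> history x T \<in> reachable"
  by (auto simp: reachable_def)

text \<open>By superposition, as a zero initial state is preserved by sums and multiples. This makes
  \<open>L2_closure\<close> the closure of the reachable set from here on.\<close>

sublocale L2_subspace "history_interval N \<Lambda>" reachable
proof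
  show "bounded (history_interval N \<Lambda>)" "history_interval N \<Lambda> \<in> sets lebesgue"
    by (fact history_interval_domain)+
  show "reachable \<subseteq> L2_space (history_interval N \<Lambda>)"
    using history_in_state_space L2_space_zero by (fastforce simp: reachable_def state_space_def)
  have "is_solution N A B \<Lambda> T (\<lambda>_. 0) (\<lambda>_. 0) (\<lambda>_. 0)" by (simp add: is_solution_def)
  then have "history (\<lambda>_. 0) T \<in> reachable"
    by (rule reachableI[rotated]) (simp add: control_space_def L2_space_zero)
  then show "(\<lambda>s. 0) \<in> reachable" by (simp add: history_def)
  show "(\<lambda>s. f s + g s) \<in> reachable" if fg: "f \<in> reachable" "g \<in> reachable" for f g
  proof -
    obtain u x where 1: "u \<in> control_space T" "is_solution N A B \<Lambda> T (\<lambda>_. 0) u x" "f = history x T"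
      using fg(1) unfolding reachable_def by blast
    obtain u' x' where 2: "u' \<in> control_space T" "is_solution N A B \<Lambda> T (\<lambda>_. 0) u' x'" "g = history x' T"
      using fg(2) unfolding reachable_def by blast
    have "history (\<lambda>s. x s + x' s) T \<in> reachable"
    proof (rule reachableI)
      show "(\<lambda>s. u s + u' s) \<in> control_space T"
        using 1(1) 2(1) L2_space_add unfolding control_space_def by blast
      show "is_solution N A B \<Lambda> T (\<lambda>_. 0) (\<lambda>s. u s + u' s) (\<lambda>s. x s + x' s)"
        using is_solution_add[OF 1(2) 2(2)] by simp
    qed
    then show ?thesis by (simp add: history_def 1(3) 2(3))
  qed
  show "(\<lambda>s. c *\<^sub>R f s) \<in> reachable" if f: "f \<in> reachable" for c f
  proof -
    obtain u x where 1: "u \<in> control_space T" "is_solution N A B \<Lambda> T (\<lambda>_. 0) u x" "f = history x T"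
      using f unfolding reachable_def by blast
    have "history (\<lambda>s. c *\<^sub>R x s) T \<in> reachable"
    proof (rule reachableI)
      show "(\<lambda>s. c *\<^sub>R u s) \<in> control_space T"
        using 1(1) L2_space_scaleR unfolding control_space_def by blast
      show "is_solution N A B \<Lambda> T (\<lambda>_. 0) (\<lambda>s. c *\<^sub>R u s) (\<lambda>s. c *\<^sub>R x s)"
        using is_solution_scaleR[OF 1(2), of c] by simp
    qed
    then show ?thesis by (simp add: history_def 1(3))
  qed
qed

lemma const_in_state_space: "(\<lambda>s. c) \<in> state_space N \<Lambda>"
  unfolding state_space_def by (rule L2_space_const[OF history_interval_domain])

text \<open>The shift \<open>c\<close> serves two uses: \<open>c = - \<Lambda> j\<close> for the
  delayed terms and \<open>c = T\<close> for the final window, which reaches into the past when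
  \<open>T\<close> is shorter than the largest delay.\<close>

lemma AE_past_zero:
  assumes "is_solution N A B \<Lambda> T (\<lambda>_. 0) u x"
  shows "AE r in lebesgue. - max_delay N \<Lambda> < c + r \<and> c + r \<le> 0 \<longrightarrow> zero_extension {0<..<T} x (c + r) = x (c + r)"
proof -
  have "AE s in lebesgue. s \<in> history_interval N \<Lambda> \<longrightarrow> x s = 0"
    using assms history_interval_domain(2) by (simp add: is_solution_def AE_restrict_space_iff)
  with AE_lebesgue_neq[of 0]
  have "AE s in lebesgue. - max_delay N \<Lambda> < s \<and> s \<le> 0 \<longrightarrow> zero_extension {0<..<T} x s = x s"
    by eventually_elim (auto simp: zero_extension_def history_interval_def)
  then show ?thesis by (rule AE_lebesgue_translate)
qed

text \<open>The zero extension of \<open>x\<close> satisfies the equation with zero-extended control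
  almost everywhere before \<open>T\<close>. Integration commutes with shifts and matrices, so the
  primitives satisfy it at every time up to \<open>T\<close>.\<close>

lemma is_solution_primitive:
  assumes sol: "is_solution N A B \<Lambda> T (\<lambda>_. 0) u x" and u: "u \<in> control_space T"
  shows "is_solution N A B \<Lambda> T (\<lambda>_. 0) (primitive (zero_extension {0<..<T} u)) (primitive (zero_extension {0<..<T} x))"
proof -
  let ?x = "zero_extension {0<..<T} x" and ?u = "zero_extension {0<..<T} u"
  have "x \<in> L2_space {0<..<T}"
    by (rule L2_space_subset[OF solution_in_L2[OF sol const_in_state_space u]])
      (use max_delay_pos in auto)
  then have int_x: "integrable lebesgue ?x"
    by (intro zero_extension_integrable) auto
  have int_u: "integrable lebesgue ?u"
    using u by (intro zero_extension_integrable) (auto simp: control_space_def)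
  have lin: "integrable lebesgue (\<lambda>r. M *v f r)" if "integrable lebesgue f"
    for M :: "complex^'n^'k" and f
    by (rule integrable_bounded_linear[OF matrix_vector_mul_bounded_linear that])
  note lin_x = lin[OF integrable_shift[OF int_x]]
  let ?rhs = "\<lambda>r. (\<Sum>j=1..N. A j *v ?x (r - \<Lambda> j)) + B *v ?u r"
  have eq: "AE r in lebesgue. r \<in> {0<..<T} \<longrightarrow> x r = (\<Sum>j=1..N. A j *v x (r - \<Lambda> j)) + B *v u r"
    using sol by (simp add: is_solution_def AE_restrict_space_iff)
  \<comment> \<open>The exceptional set depends on \<open>j\<close>; there are finitely many delays,
    so one null set serves all.\<close>
  have past: "AE r in lebesgue. \<forall>j\<in>{1..N}. - max_delay N \<Lambda> < - \<Lambda> j + r \<and> - \<Lambda> j + r \<le> 0 \<longrightarrow> ?x (- \<Lambda> j + r) = x (- \<Lambda> j + r)"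
    by (intro AE_finite_allI AE_past_zero[OF sol]) simp
  have xeq: "AE r in lebesgue. r < T \<longrightarrow> ?x r = ?rhs r"
    using eq past
  proof eventually_elim
    case (elim r)
    show ?case
    proof (cases "r \<le> 0")
      case True
      then have "?x (r - \<Lambda> j) = 0" if "j \<in> {1..N}" for j
        using delay_pos[OF that] by (simp add: zero_extension_def)
      then show ?thesis using True by (simp add: zero_extension_def)
    next
      case False
      have "?x (r - \<Lambda> j) = x (r - \<Lambda> j)" if "r < T" "j \<in> {1..N}" for j
      proof (cases "r - \<Lambda> j \<le> 0")
        case True
        have "- max_delay N \<Lambda> < - \<Lambda> j + r \<and> - \<Lambda> j + r \<le> 0"
          using True False delay_bounds(1)[OF that(2)] by auto
        then show ?thesis using elim(2) that(2) by (simp add: add.commute)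
      next
        case False
        then show ?thesis using that delay_pos[OF that(2)] by (simp add: zero_extension_def)
      qed
      then show ?thesis using False elim(1) by (simp add: zero_extension_def)
    qed
  qed
  have "primitive ?x t = (\<Sum>j=1..N. A j *v primitive ?x (t - \<Lambda> j)) + B *v primitive ?u t" if "t \<le> T" for t
  proof -
    have "primitive ?x t = primitive ?rhs t"
    proof (rule primitive_AE_cong[OF int_x])
      show "integrable lebesgue ?rhs"
        by (intro Bochner_Integration.integrable_add Bochner_Integration.integrable_sum lin_x lin int_u)
      show "AE r in lebesgue. r < t \<longrightarrow> ?x r = ?rhs r"
        using xeq that by (auto elim!: eventually_mono)
    qed
    also have "\<dots> = primitive (\<lambda>r. \<Sum>j=1..N. A j *v ?x (r - \<Lambda> j)) t + primitive (\<lambda>r. B *v ?u r) t"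
      by (intro primitive_add Bochner_Integration.integrable_sum lin_x lin int_u)
    also have "primitive (\<lambda>r. \<Sum>j=1..N. A j *v ?x (r - \<Lambda> j)) t = (\<Sum>j=1..N. primitive (\<lambda>r. A j *v ?x (r - \<Lambda> j)) t)"
      by (intro primitive_sum lin_x)
    also have "\<dots> = (\<Sum>j=1..N. A j *v primitive ?x (t - \<Lambda> j))"
      by (rule sum.cong[OF refl])
        (simp add: primitive_bounded_linear[OF integrable_shift[OF int_x] matrix_vector_mul_bounded_linear] primitive_shift[of ?x])
    also have "primitive (\<lambda>r. B *v ?u r) t = B *v primitive ?u t"
      by (rule primitive_bounded_linear[OF int_u matrix_vector_mul_bounded_linear])
    finally show ?thesis .
  qed
  moreover have "primitive ?x t = 0" if "t \<le> 0" for t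
  proof -
    have "(\<lambda>r. if r \<le> t then ?x r else 0) = (\<lambda>r. 0)"
      using that by (auto simp: fun_eq_iff zero_extension_def)
    then show ?thesis by (simp add: primitive_def)
  qed
  ultimately show ?thesis
    unfolding is_solution_def by (auto simp: history_interval_def intro!: AE_I2)
qed

text \<open>The witness \<open>w'\<close> is the final state of the primitive of the solution,
  reached with the primitive of the control. The constant \<open>c\<close> is the integral of the
  solution up to the time \<open>T - max_delay N \<Lambda>\<close> at which the window
  opens.\<close>

lemma reachable_primitive:
  assumes "w \<in> reachable"
  shows "\<exists>w'\<in>reachable. \<exists>c. \<forall>s\<in>history_interval N \<Lambda>.
    w' s = c + primitive (zero_extension (history_interval N \<Lambda>) w) s"
proof -
  obtain u x where u: "u \<in> control_space T" and sol: "is_solution N A B \<Lambda> T (\<lambda>_. 0) u x"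
    and w: "w = history x T"
    using assms unfolding reachable_def by blast
  let ?x = "zero_extension {0<..<T} x" and ?u = "zero_extension {0<..<T} u"
  let ?L = "max_delay N \<Lambda>"
  have "x \<in> L2_space {0<..<T}"
    by (rule L2_space_subset[OF solution_in_L2[OF sol const_in_state_space u]])
      (use max_delay_pos in auto)
  then have int_x: "integrable lebesgue ?x"
    by (intro zero_extension_integrable) auto
  have int_u: "integrable lebesgue ?u"
    using u by (intro zero_extension_integrable) (auto simp: control_space_def)
  have U: "primitive ?u \<in> control_space T"
    unfolding control_space_def by (rule primitive_in_L2[OF int_u]) auto
  have int_shift: "integrable lebesgue (\<lambda>r. ?x (T + r))"
    using integrable_shift[OF int_x, of "-T"] by (simp add: add.commute)
  have "w \<in> L2_space (history_interval N \<Lambda>)"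
    using subset_L2 assms by blast
  then have int_w: "integrable lebesgue (zero_extension {-?L<..<0} w)"
    using zero_extension_integrable[OF history_interval_domain] by (simp add: history_interval_def)
  \<comment> \<open>On the final window, \<open>x\<close> and its zero extension agree almost
    everywhere, including the part of the window that lies before time 0.\<close>
  have ae: "AE r in lebesgue. r < s \<longrightarrow> zero_extension {-?L<..<0} (\<lambda>r. ?x (T + r)) r = zero_extension {-?L<..<0} w r" for s
    using AE_past_zero[OF sol, of T]
  proof eventually_elim
    case (elim r)
    show ?case
    proof (cases "r \<in> {-?L<..<0}")
      case True
      have "?x (T + r) = x (T + r)"
      proof (cases "T + r \<le> 0")
        case True
        then show ?thesis using elim \<open>r \<in> {-?L<..<0}\<close> T_pos by auto
      next
        case False
        then show ?thesis using \<open>r \<in> {-?L<..<0}\<close> by (simp add: zero_extension_def)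
      qed
      with True show ?thesis by (simp add: zero_extension_def[of "{-?L<..<0}"] w history_def)
    qed (auto simp: zero_extension_def[of "{-?L<..<0}"])
  qed
  have "history (primitive ?x) T s = primitive ?x (T + - ?L) + primitive (zero_extension (history_interval N \<Lambda>) w) s"
    if "s \<in> history_interval N \<Lambda>" for s
  proof -
    have s: "-?L < s" "s < 0" using that by (auto simp: history_interval_def)
    have "integrable lebesgue (zero_extension {-?L<..<0} (\<lambda>r. ?x (T + r)))"
    proof -
      have "integrable lebesgue (\<lambda>r. indicator {-?L<..<0} r *\<^sub>R ?x (T + r))"
        using int_shift integrable_mult_indicator[of "{-?L<..<0}" lebesgue "\<lambda>r. ?x (T + r)"] by simp
      also have "(\<lambda>r. indicator {-?L<..<0} r *\<^sub>R ?x (T + r)) = zero_extension {-?L<..<0} (\<lambda>r. ?x (T + r))"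
        by (simp add: fun_eq_iff zero_extension_def[of "{-?L<..<0}"])
      finally show ?thesis .
    qed
    from primitive_AE_cong[OF this int_w ae]
    have "primitive (zero_extension {-?L<..<0} (\<lambda>r. ?x (T + r))) s = primitive (zero_extension {-?L<..<0} w) s" .
    moreover have "primitive (zero_extension {-?L<..<0} (\<lambda>r. ?x (T + r))) s = primitive ?x (T + s) - primitive ?x (T + - ?L)"
      by (rule primitive_window[OF int_x s])
    ultimately have "primitive ?x (T + s) - primitive ?x (T + - ?L) = primitive (zero_extension {-?L<..<0} w) s"
      by (rule trans[OF sym, rotated])
    then show ?thesis
      unfolding history_def history_interval_def diff_eq_eq by (simp only: add.commute)
  qed
  then show ?thesis
    using reachableI[OF U is_solution_primitive[OF sol u]] by blast
qed

section \<open>Controllability as density of the reachable set\<close>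

lemma steers_near_iff:
  assumes "x0 \<in> state_space N \<Lambda>" "u \<in> control_space T" "\<epsilon> > 0"
  shows "steers_near N A B \<Lambda> T x0 u y \<epsilon> \<longleftrightarrow>
    (\<exists>x. is_solution N A B \<Lambda> T x0 u x \<and> sqdist (history x T) y < \<epsilon>\<^sup>2)"
  using history_in_state_space assms by (auto simp: steers_near_def L2_norm_less_iff sqdist_def)

lemma closure_if_controllable_to_constants:
  assumes "approx_controllable_to_constants N A B \<Lambda> T"
  shows "(\<lambda>s. v) \<in> L2_closure"
  unfolding L2_closure_def
proof (intro CollectI conjI allI impI)
  show "(\<lambda>s. v) \<in> L2_space (history_interval N \<Lambda>)"
    using const_in_state_space by (simp add: state_space_def)
  fix \<epsilon> :: real assume "\<epsilon> > 0"
  then have "sqrt \<epsilon> > 0" by simp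
  moreover have "(\<lambda>s. v) \<in> constant_states N \<Lambda>" by (auto simp: constant_states_def)
  ultimately obtain u where u: "u \<in> control_space T" "steers_near N A B \<Lambda> T (\<lambda>_. 0) u (\<lambda>s. v) (sqrt \<epsilon>)"
    using assms unfolding approx_controllable_to_constants_def by blast
  with \<open>\<epsilon> > 0\<close> obtain x where "is_solution N A B \<Lambda> T (\<lambda>_. 0) u x" "sqdist (history x T) (\<lambda>s. v) < \<epsilon>"
    by (auto simp: steers_near_iff[OF const_in_state_space])
  with u(1) show "\<exists>w\<in>reachable. sqdist w (\<lambda>s. v) < \<epsilon>"
    using reachableI by blast
qed

lemma controllable_iff:
  "approx_controllable N A B \<Lambda> T \<longleftrightarrow> approx_controllable_to_constants N A B \<Lambda> T"
proof
  assume ctrl: "approx_controllable N A B \<Lambda> T"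
  show "approx_controllable_to_constants N A B \<Lambda> T"
    unfolding approx_controllable_to_constants_def
  proof (intro ballI allI impI)
    fix y :: "real \<Rightarrow> complex^'d" and \<epsilon> :: real
    assume "y \<in> constant_states N \<Lambda>" and \<epsilon>: "\<epsilon> > 0"
    then obtain c where c: "\<And>s. s \<in> history_interval N \<Lambda> \<Longrightarrow> y s = c"
      by (auto simp: constant_states_def)
    \<comment> \<open>\<open>y\<close> is constant only on the history interval and arbitrary
      elsewhere, so it is compared there with a globally constant function.\<close>
    have "y \<in> state_space N \<Lambda>"
      unfolding state_space_def
    proof (rule L2_space_AE_cong)
      show "(\<lambda>s. c) \<in> L2_space (history_interval N \<Lambda>)"
        using const_in_state_space by (simp add: state_space_def)
      show "AE s in lebesgue_on (history_interval N \<Lambda>). c = y s"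
        by (rule AE_I2) (simp add: c)
    qed (rule history_interval_domain)
    with ctrl \<epsilon> const_in_state_space[of 0]
    show "\<exists>u\<in>control_space T. steers_near N A B \<Lambda> T (\<lambda>_. 0) u y \<epsilon>"
      unfolding approx_controllable_def by blast
  qed
next
  assume "approx_controllable_to_constants N A B \<Lambda> T"
  then have closure: "L2_closure = L2_space (history_interval N \<Lambda>)"
    using closure_eq_L2_if_primitive[OF history_interval_def closure_if_controllable_to_constants reachable_primitive]
    by blast
  show "approx_controllable N A B \<Lambda> T"
    unfolding approx_controllable_def
  proof (intro ballI allI impI)
    fix x0 y :: "real \<Rightarrow> complex^'d" and \<epsilon> :: real
    assume x0: "x0 \<in> state_space N \<Lambda>" and y: "y \<in> state_space N \<Lambda>" and \<epsilon>: "\<epsilon> > 0"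
    have zero: "(\<lambda>_. 0) \<in> (control_space T :: (real \<Rightarrow> complex^'m) set)"
      by (simp add: control_space_def L2_space_zero)
    \<comment> \<open>The uncontrolled evolution of \<open>x0\<close>. Steering \<open>x0\<close>
      near \<open>y\<close> amounts to steering zero near \<open>y\<close> minus the final state of
      this evolution.\<close>
    obtain x where x: "is_solution N A B \<Lambda> T x0 (\<lambda>_. 0) x"
      using exists_solution by blast
    let ?z = "\<lambda>s. y s - history x T s"
    have "?z \<in> L2_closure"
      using y history_in_state_space[OF x x0 zero]
      unfolding closure state_space_def by (rule L2_space_diff)
    then obtain w where "w \<in> reachable" "sqdist w ?z < \<epsilon>\<^sup>2"
      using closure_approx[of ?z "\<epsilon>\<^sup>2"] \<epsilon> by auto
    then obtain u x' where u: "u \<in> control_space T" and x': "is_solution N A B \<Lambda> T (\<lambda>_. 0) u x'"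
      and close: "sqdist (history x' T) ?z < \<epsilon>\<^sup>2"
      unfolding reachable_def by blast
    have "is_solution N A B \<Lambda> T x0 u (\<lambda>s. x s + x' s)"
      using is_solution_add[OF x x'] by simp
    moreover have "sqdist (history (\<lambda>s. x s + x' s) T) y < \<epsilon>\<^sup>2"
      using close by (simp add: sqdist_def history_def algebra_simps)
    ultimately have "steers_near N A B \<Lambda> T x0 u y \<epsilon>"
      using steers_near_iff[OF x0 u \<epsilon>] by blast
    with u show "\<exists>u\<in>control_space T. steers_near N A B \<Lambda> T x0 u y \<epsilon>" by blast
  qed
qed

end

theorem theorem5p6:
  fixes N :: nat
    and A :: "nat \<Rightarrow> complex^'d^'d"
    and B :: "complex^'m^'d"
    and \<Lambda> :: "nat \<Rightarrow> real"
    and T :: real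
  assumes "N \<ge> 1"
    and "\<And>j. j \<in> {1..N} \<Longrightarrow> \<Lambda> j > 0"
    and "T > 0"
  shows "approx_controllable N A B \<Lambda> T \<longleftrightarrow> approx_controllable_to_constants N A B \<Lambda> T"
proof -
  interpret difference_equation N A B \<Lambda> T
    using assms by unfold_locales
  show ?thesis by (rule controllable_iff)
qed

end
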